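(* Let $f$ be a penalty of max-linear form (see context) with pattern function $I$ and set of patterns $\mathfrak P$. Let $f_n=n^{1/2}f$, let $\hat\beta_n$ be the minimizer over $\beta\in\mathbb{R}^p$ of $\frac12\Vert y-X\beta\Vert_2^2+f_n(\beta)$ in the linear model described in the context with $C$ positive definite, and let $\hat u$ be the minimizer of $V(u)=\frac12u^TCu-u^TW+f'(\beta^0;u)$, where $W\sim\mathcal N(0,\sigma^2C)$. Then for every pattern $\mathfrak p\in\mathfrak P$, $$\mathbb P[I(\hat\beta_n)=\mathfrak p]\longrightarrow\mathbb P[I_{\beta^0}(\hat u)=\mathfrak p]\quad\text{as }n\to\infty,$$ where $I_{\beta^0}(\hat u)=\lim_{\varepsilon\downarrow0}I(\beta^0+\varepsilon\hat u)$ is the limiting pattern of $\hat u$ with respect to $\beta^0$.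
   Context: Linear model: $p$ is fixed and $\beta^0\in\mathbb{R}^p$ is a fixed vector. For each $n$, $y=X\beta^0+\varepsilon$ with $X=(X_1,\dots,X_n)^T\in\mathbb{R}^{n\times p}$ and $\varepsilon=(\varepsilon_1,\dots,\varepsilon_n)^T$, where $X_1,X_2,\dots$ are i.i.d. centered random vectors in $\mathbb{R}^p$ with covariance matrix $C$, $\varepsilon_1,\varepsilon_2,\dots$ are i.i.d. centered random variables with variance $\sigma^2>0$, and the sequences $(X_i)$ and $(\varepsilon_i)$ are independent. Convention: $\hat\beta_n$ is a random vector which is a minimizer of the stated objective whenever one exists. Max-linear form: $f(x)=\max\{\langle v_i,x\rangle:i\in\mathcal S\}+g(x)$ on $\mathbb{R}^p$, where $\mathcal S$ is a finite index set, $g:\mathbb{R}^p\to\mathbb{R}$ is convex and continuously differentiable, and $v_i$ ($i\in\mathcal S$) are distinct vectors in $\mathbb{R}^p$ such that $v_i$ is not in the convex hull of $\{v_j:j\neq i\}$ for every $i\in\mathcal S$. Pattern: $I(x)=\operatorname{argmax}_{i\in\mathcal S}\langle v_i,x\rangle\subset\mathcal S$; $\mathfrak P=\{I(x):x\in\mathbb{R}^p\}$. Limiting pattern of $u$ with respect to $x$: $I_x(u)=\operatorname{argmax}_{i\in I(x)}\langle v_i,u\rangle$, which equals $\lim_{\varepsilon\downarrow0}I(x+\varepsilon u)$ (the set $I(x+\varepsilon u)$ is eventually constant as $\varepsilon\downarrow0$). Directional derivative: $f'(x;u)=\lim_{t\downarrow0}\frac{f(x+tu)-f(x)}{t}$.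 *)

theory Defs
  imports "HOL-Probability.Probability"
begin

section \<open>Penalties of max-linear form and their patterns\<close>

definition argmax_set :: "'i set \<Rightarrow> ('i \<Rightarrow> real) \<Rightarrow> 'i set" where
  "argmax_set A h = {i \<in> A. \<forall>j\<in>A. h j \<le> h i}"

definition pattern :: "'i set \<Rightarrow> ('i \<Rightarrow> 'v::real_inner) \<Rightarrow> 'v \<Rightarrow> 'i set" where
  "pattern S v x = argmax_set S (\<lambda>i. v i \<bullet> x)"

definition patterns :: "'i set \<Rightarrow> ('i \<Rightarrow> 'v::real_inner) \<Rightarrow> 'i set set" where
  "patterns S v = range (pattern S v)"

text \<open>The limit of \<open>pattern S v (x + \<epsilon> u)\<close> as \<open>\<epsilon>\<close> decreases to 0;
  see \<open>eventually_pattern_eq_limiting_pattern\<close> below.\<close>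

definition limiting_pattern ::
  "'i set \<Rightarrow> ('i \<Rightarrow> 'v::real_inner) \<Rightarrow> 'v \<Rightarrow> 'v \<Rightarrow> 'i set" where
  "limiting_pattern S v x u = argmax_set (pattern S v x) (\<lambda>i. v i \<bullet> u)"

definition max_linear_form ::
  "('v::euclidean_space \<Rightarrow> real) \<Rightarrow> 'i set \<Rightarrow> ('i \<Rightarrow> 'v) \<Rightarrow> ('v \<Rightarrow> real) \<Rightarrow> bool" where
  "max_linear_form f S v g \<longleftrightarrow>
     finite S \<and> S \<noteq> {} \<and>
     inj_on v S \<and> (\<forall>i\<in>S. v i \<notin> convex hull (v ` (S - {i}))) \<and>
     convex_on UNIV g \<and>
     (\<exists>G. (\<forall>x. GDERIV g x :> G x) \<and> continuous_on UNIV G) \<and>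
     (\<forall>x. f x = Max ((\<lambda>i. v i \<bullet> x) ` S) + g x)"

definition dir_deriv :: "('v::real_normed_vector \<Rightarrow> real) \<Rightarrow> 'v \<Rightarrow> 'v \<Rightarrow> real" where
  "dir_deriv f x u = Lim (at_right 0) (\<lambda>t::real. (f (x + t *\<^sub>R u) - f x) / t)"

lemma eventually_pattern_eq_limiting_pattern:
  fixes v :: "'i \<Rightarrow> 'v::real_inner"
  assumes "finite S"
  shows "eventually (\<lambda>\<epsilon>. pattern S v (x + \<epsilon> *\<^sub>R u) = limiting_pattern S v x u) (at_right (0::real))"
proof -
  define a where "a i j = v j \<bullet> x - v i \<bullet> x" for i j
  define b where "b i j = v j \<bullet> u - v i \<bullet> u" for i j
  have *: "eventually (\<lambda>\<epsilon>. (a i j + \<epsilon> * b i j \<le> 0) = (a i j < 0 \<or> a i j = 0 \<and> b i j \<le> 0))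
             (at_right (0::real))" for i j
  proof -
    have lim: "((\<lambda>\<epsilon>. a i j + \<epsilon> * b i j) \<longlongrightarrow> a i j) (at_right (0::real))"
      by (auto intro!: tendsto_eq_intros)
    consider "a i j < 0" | "a i j > 0" | "a i j = 0" by linarith
    then show ?thesis
    proof cases
      case 1
      show ?thesis by (rule eventually_mono[OF order_tendstoD(2)[OF lim 1]]) (use 1 in auto)
    next
      case 2
      show ?thesis by (rule eventually_mono[OF order_tendstoD(1)[OF lim 2]]) (use 2 in auto)
    next
      case 3
      show ?thesis
        by (rule eventually_mono[OF eventually_at_right_less])
          (use 3 in \<open>auto simp: mult_le_0_iff\<close>)
    qed
  qed
  have "eventually (\<lambda>\<epsilon>. \<forall>i\<in>S. \<forall>j\<in>S.
          (a i j + \<epsilon> * b i j \<le> 0) = (a i j < 0 \<or> a i j = 0 \<and> b i j \<le> 0)) (at_right (0::real))"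
    using assms * by (intro eventually_ball_finite ballI) auto
  then show ?thesis
  proof (rule eventually_mono)
    fix \<epsilon> :: real
    assume H: "\<forall>i\<in>S. \<forall>j\<in>S. (a i j + \<epsilon> * b i j \<le> 0) = (a i j < 0 \<or> a i j = 0 \<and> b i j \<le> 0)"
    have "pattern S v (x + \<epsilon> *\<^sub>R u) = {i \<in> S. \<forall>j\<in>S. a i j + \<epsilon> * b i j \<le> 0}"
      unfolding pattern_def argmax_set_def a_def b_def
      by (auto simp: inner_right_distrib algebra_simps)
    also have "\<dots> = {i \<in> S. \<forall>j\<in>S. a i j < 0 \<or> a i j = 0 \<and> b i j \<le> 0}"
      using H by blast
    also have "\<dots> = limiting_pattern S v x u"
      unfolding limiting_pattern_def pattern_def argmax_set_def a_def b_def
      by (auto; force)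
    finally show "pattern S v (x + \<epsilon> *\<^sub>R u) = limiting_pattern S v x u" .
  qed
qed

section \<open>The probabilistic model\<close>

definition iid :: "'a measure \<Rightarrow> 'b measure \<Rightarrow> (nat \<Rightarrow> 'a \<Rightarrow> 'b) \<Rightarrow> bool" where
  "iid M B Z \<longleftrightarrow>
     prob_space.indep_vars M (\<lambda>_. B) Z UNIV \<and> (\<forall>i. distr M B (Z i) = distr M B (Z 0))"

text \<open>Independence of the generated \<open>\<sigma>\<close>-algebras; the library's \<open>indep_var\<close> would need
  both sequences to have the same type.\<close>

definition indep_sequences ::
  "'a measure \<Rightarrow> (nat \<Rightarrow> 'a \<Rightarrow> 'b::topological_space) \<Rightarrow> (nat \<Rightarrow> 'a \<Rightarrow> 'c::topological_space) \<Rightarrow> bool"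
  where
  "indep_sequences M Y Z \<longleftrightarrow>
     prob_space.indep_set M
       (sets (vimage_algebra (space M) (\<lambda>\<omega> i. Y i \<omega>) (Pi\<^sub>M (UNIV::nat set) (\<lambda>_. borel))))
       (sets (vimage_algebra (space M) (\<lambda>\<omega> i. Z i \<omega>) (Pi\<^sub>M (UNIV::nat set) (\<lambda>_. borel))))"

definition centered_with_covariance ::
  "'a measure \<Rightarrow> ('a \<Rightarrow> real ^ 'p) \<Rightarrow> real ^ 'p ^ 'p \<Rightarrow> bool" where
  "centered_with_covariance M Y C \<longleftrightarrow>
     Y \<in> borel_measurable M \<and> integrable M Y \<and> integrable M (\<lambda>\<omega>. (norm (Y \<omega>))\<^sup>2) \<and>
     (\<integral>\<omega>. Y \<omega> \<partial>M) = 0 \<and>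
     (\<forall>j k. C $ j $ k = (\<integral>\<omega>. Y \<omega> $ j * Y \<omega> $ k \<partial>M))"

definition centered_with_variance :: "'a measure \<Rightarrow> ('a \<Rightarrow> real) \<Rightarrow> real \<Rightarrow> bool" where
  "centered_with_variance M Z s \<longleftrightarrow>
     Z \<in> borel_measurable M \<and> integrable M Z \<and> integrable M (\<lambda>\<omega>. (Z \<omega>)\<^sup>2) \<and>
     (\<integral>\<omega>. Z \<omega> \<partial>M) = 0 \<and> s = (\<integral>\<omega>. (Z \<omega>)\<^sup>2 \<partial>M)"

definition pos_def_matrix :: "real ^ 'p ^ 'p \<Rightarrow> bool" where
  "pos_def_matrix C \<longleftrightarrow> transpose C = C \<and> (\<forall>x. x \<noteq> 0 \<longrightarrow> 0 < x \<bullet> (C *v x))"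

text \<open>Gaussian vector with mean \<open>\<mu>\<close> and covariance \<open>\<Sigma>\<close>: every linear functional
  \<open>t \<bullet> W\<close> has the univariate normal law with mean \<open>t \<bullet> \<mu>\<close> and variance
  \<open>t \<bullet> \<Sigma> t\<close>, which is a point mass if the variance is 0 (for positive definite
  \<open>\<Sigma>\<close> only for \<open>t = 0\<close>). The library's \<open>normal_density\<close> takes the standard
  deviation.\<close>

definition normal_law :: "real \<Rightarrow> real \<Rightarrow> real measure" where
  "normal_law m s2 =
     (if s2 > 0 then density lborel (\<lambda>x. ennreal (normal_density m (sqrt s2) x))
      else return borel m)"

definition multivariate_normal ::
  "'a measure \<Rightarrow> ('a \<Rightarrow> real ^ 'p) \<Rightarrow> real ^ 'p \<Rightarrow> real ^ 'p ^ 'p \<Rightarrow> bool" where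
  "multivariate_normal M W \<mu> \<Sigma> \<longleftrightarrow>
     W \<in> borel_measurable M \<and>
     (\<forall>t. distr M borel (\<lambda>\<omega>. t \<bullet> W \<omega>) = normal_law (t \<bullet> \<mu>) (t \<bullet> (\<Sigma> *v t)))"

section \<open>Objective functions\<close>

text \<open>The sample size \<open>n\<close> varies, so the rows of the design matrix and the entries of the
  response are sequences of which the first \<open>n\<close> terms (indices \<open>0, \<dots>, n - 1\<close>) are
  used; the sum is the squared Euclidean norm of \<open>y - X b\<close>.\<close>

definition penalized_ls ::
  "nat \<Rightarrow> (nat \<Rightarrow> real ^ 'p) \<Rightarrow> (nat \<Rightarrow> real) \<Rightarrow> (real ^ 'p \<Rightarrow> real) \<Rightarrow> real ^ 'p \<Rightarrow> real" where
  "penalized_ls n x y pen b = 1 / 2 * (\<Sum>i<n. (y i - x i \<bullet> b)\<^sup>2) + pen b"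

definition limit_objective ::
  "real ^ 'p ^ 'p \<Rightarrow> real ^ 'p \<Rightarrow> (real ^ 'p \<Rightarrow> real) \<Rightarrow> real ^ 'p \<Rightarrow> real ^ 'p \<Rightarrow> real" where
  "limit_objective C w f b0 u = 1 / 2 * (u \<bullet> (C *v u)) - u \<bullet> w + dir_deriv f b0 u"

definition is_minimizer :: "('b \<Rightarrow> real) \<Rightarrow> 'b \<Rightarrow> bool" where
  "is_minimizer F b \<longleftrightarrow> is_arg_min F (\<lambda>_. True) b"

end

theory Submission
  imports Defs
begin

text \<open>With \<open>r = 1 / sqrt n\<close> the rescaled error \<open>(\<beta>hat n - \<beta>\<^sub>0) / r\<close> minimizes
  \<open>u \<bullet> A u / 2 - u \<bullet> w + (f (\<beta>\<^sub>0 + r u) - f \<beta>\<^sub>0) / r\<close>, where the normalized Gram matrix \<open>A\<close>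
  converges to \<open>C\<close> in probability and the score \<open>w\<close> converges to \<open>W\<close> in distribution. If \<open>w\<close>
  avoids finitely many hyperplanes, which are null sets for \<open>W\<close>, then the pattern of the minimizer
  is constant for small \<open>r\<close>, \<open>A\<close> near \<open>C\<close> and \<open>w\<close> in a small neighbourhood, and it is the
  limiting pattern of the minimizer of the limit objective; the neighbourhood is uniform on
  compact sets of such \<open>w\<close>. Inner regularity of the law of \<open>W\<close> then yields
  \<open>P (limiting pattern = p) \<le> liminf P (pattern = p)\<close> for every \<open>p\<close>, and equality holds in the
  limit because both families of probabilities sum to 1. Convergence of \<open>E h\<close> along the scores for
  bounded continuous \<open>h\<close> is reduced to \<open>h x = cos (t \<bullet> x + c)\<close>, that is, to the one-dimensional
  central limit theorem.\<close>

section \<open>Limit theorems\<close>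

text \<open>Convergence in distribution of the rescaled error does not by itself give convergence of
  pattern probabilities: \<open>pattern\<close> is discontinuous, and the limit minimizer may
  satisfy exact ties with positive probability, as zero coefficients of the Lasso do. Continuity
  yields only one inclusion: indices that lose in the limit also lose before it. That the ties of
  the limit are already present before it comes from optimality. A minimizer with fewer ties is
  stationary in a larger space of directions, and in the limit this imposes a linear equation on the
  score; the hyperplanes are these equations. The penalty weight \<open>sqrt n\<close> is
  \<open>1 / r\<close>, so the penalty contributes a difference quotient of the same order as the
  quadratic part. The Gram matrix has a constant limit, so no joint convergence in distribution is
  needed: the event that it is far from \<open>C\<close> is discarded.\<close>

text \<open>Independence and centring remove the cross terms. The identity serves twice: for the
  truncated means in the weak law and for the tightness of the scores.\<close>

lemma (in prob_space) second_moment_indep_sum: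
  fixes Z :: "nat \<Rightarrow> 'a \<Rightarrow> real"
  assumes indep: "indep_vars (\<lambda>_. borel) Z UNIV"
    and sq: "\<And>i. integrable M (\<lambda>\<omega>. (Z i \<omega>)\<^sup>2)"
    and mean: "\<And>i. expectation (Z i) = 0"
    and var: "\<And>i. expectation (\<lambda>\<omega>. (Z i \<omega>)\<^sup>2) = s"
  shows "integrable M (\<lambda>\<omega>. (\<Sum>i<n. Z i \<omega>)\<^sup>2)"
    and "expectation (\<lambda>\<omega>. (\<Sum>i<n. Z i \<omega>)\<^sup>2) = real n * s"
proof -
  have [measurable]: "Z i \<in> borel_measurable M" for i
    using indep unfolding indep_vars_def2 by simp
  have int: "integrable M (Z i)" for i
    by (rule square_integrable_imp_integrable[OF _ sq]) simp
  have prod: "integrable M (\<lambda>\<omega>. Z i \<omega> * Z j \<omega>) \<and>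
      expectation (\<lambda>\<omega>. Z i \<omega> * Z j \<omega>) = (if i = j then s else 0)" for i j
  proof (cases "i = j")
    case True
    then show ?thesis using sq var by (simp flip: power2_eq_square)
  next
    case False
    have ij: "indep_vars (\<lambda>_. borel) Z {i, j}"
      by (rule indep_vars_subset[OF indep]) simp
    show ?thesis
      using indep_vars_integrable[OF _ ij int] indep_vars_lebesgue_integral[OF _ ij int] False mean
      by simp
  qed
  have eq: "(\<Sum>i<n. Z i \<omega>)\<^sup>2 = (\<Sum>i<n. \<Sum>j<n. Z i \<omega> * Z j \<omega>)" for \<omega>
    by (simp add: power2_eq_square sum_product)
  show "integrable M (\<lambda>\<omega>. (\<Sum>i<n. Z i \<omega>)\<^sup>2)"
    unfolding eq using prod by (intro Bochner_Integration.integrable_sum) auto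
  show "expectation (\<lambda>\<omega>. (\<Sum>i<n. Z i \<omega>)\<^sup>2) = real n * s"
    unfolding eq using prod
    by (simp add: Bochner_Integration.integral_sum Bochner_Integration.integrable_sum)
qed

lemma (in prob_space) expectation_iid:
  assumes "X \<in> borel_measurable M" "Y \<in> borel_measurable M"
    and "distr M borel X = distr M borel Y" and "h \<in> borel_measurable borel"
  shows "integrable M (\<lambda>\<omega>. h (X \<omega>) :: real) = integrable M (\<lambda>\<omega>. h (Y \<omega>))"
    and "expectation (\<lambda>\<omega>. h (X \<omega>)) = expectation (\<lambda>\<omega>. h (Y \<omega>))"
  using assms(3) integrable_distr_eq[OF assms(1,4)] integrable_distr_eq[OF assms(2,4)]
    integral_distr[OF assms(1,4)] integral_distr[OF assms(2,4)] by auto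

text \<open>The variables are truncated at a level \<open>b\<close>: the means of the truncated parts are
  controlled by their second moments, the remainders in \<open>L\<^sup>1\<close>.\<close>

theorem (in prob_space) weak_law_of_large_numbers_L1:
  fixes Z :: "nat \<Rightarrow> 'a \<Rightarrow> real"
  assumes indep: "indep_vars (\<lambda>_. borel) Z UNIV"
    and distr: "\<And>i. distr M borel (Z i) = distr M borel (Z 0)"
    and int0: "integrable M (Z 0)"
  shows "(\<lambda>n. expectation (\<lambda>\<omega>. \<bar>(\<Sum>i<n. Z i \<omega>) / real n - expectation (Z 0)\<bar>)) \<longlonglongrightarrow> 0"
proof -
  have Zm [measurable]: "Z i \<in> borel_measurable M" for i
    using indep unfolding indep_vars_def2 by simp
  have int: "integrable M (Z i)" for i
    using expectation_iid(1)[OF Zm Zm distr, of "\<lambda>x. x"] int0 by simp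
  define T where "T b x = (if \<bar>x\<bar> \<le> b then x else 0)" for b x :: real
  have [measurable]: "T b \<in> borel_measurable borel" for b
    unfolding T_def by measurable
  have remainder: "(\<lambda>b. expectation (\<lambda>\<omega>. \<bar>Z 0 \<omega> - T (real b) (Z 0 \<omega>)\<bar>)) \<longlonglongrightarrow> 0"
  proof -
    have "(\<lambda>b. expectation (\<lambda>\<omega>. \<bar>Z 0 \<omega> - T (real b) (Z 0 \<omega>)\<bar>)) \<longlonglongrightarrow> expectation (\<lambda>\<omega>. 0)"
    proof (rule integral_dominated_convergence[where w = "\<lambda>\<omega>. \<bar>Z 0 \<omega>\<bar>"])
      show "AE \<omega> in M. (\<lambda>b. \<bar>Z 0 \<omega> - T (real b) (Z 0 \<omega>)\<bar>) \<longlonglongrightarrow> 0"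
      proof (rule AE_I2)
        fix \<omega>
        obtain b0 :: nat where "\<bar>Z 0 \<omega>\<bar> \<le> real b0" using real_arch_simple by blast
        then have "eventually (\<lambda>b. \<bar>Z 0 \<omega> - T (real b) (Z 0 \<omega>)\<bar> = 0) sequentially"
          unfolding eventually_sequentially T_def by (intro exI[of _ b0]) auto
        then show "(\<lambda>b. \<bar>Z 0 \<omega> - T (real b) (Z 0 \<omega>)\<bar>) \<longlonglongrightarrow> 0" by (rule tendsto_eventually)
      qed
    qed (use int0 in \<open>auto simp: T_def\<close>)
    then show ?thesis by simp
  qed
  show ?thesis
  proof (rule LIMSEQ_I)
    fix e :: real assume e: "e > 0"
    \<comment> \<open>Error budget: \<open>e / 4\<close> from the elementary inequality below,
      \<open>e / 4\<close> from the second moment, \<open>e / 8\<close> from the averaged remainders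
      and \<open>e / 8\<close> from the mean remainder, which leaves \<open>e / 4\<close> to
      spare.\<close>
    obtain b where b: "expectation (\<lambda>\<omega>. \<bar>Z 0 \<omega> - T (real b) (Z 0 \<omega>)\<bar>) < e / 8"
      using order_tendstoD(2)[OF remainder, of "e / 8"] e
      by (auto simp: eventually_sequentially)
    define m where "m = expectation (\<lambda>\<omega>. T (real b) (Z 0 \<omega>))"
    define s where "s = expectation (\<lambda>\<omega>. (T (real b) (Z 0 \<omega>) - m)\<^sup>2)"
    define R where "R i \<omega> = Z i \<omega> - T (real b) (Z i \<omega>)" for i \<omega>
    define Y where "Y i \<omega> = T (real b) (Z i \<omega>) - m" for i \<omega>
    have [measurable]: "R i \<in> borel_measurable M" "Y i \<in> borel_measurable M" for i
      unfolding R_def Y_def by measurable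
    have intT: "integrable M (\<lambda>\<omega>. T (real b) (Z i \<omega>))" for i
      by (rule integrable_const_bound[where B = "real b"]) (auto simp: T_def)
    have intR: "integrable M (R i)" for i
      unfolding R_def using int intT by simp
    have ER: "expectation (\<lambda>\<omega>. \<bar>R i \<omega>\<bar>) < e / 8" for i
      using b expectation_iid(2)[OF Zm Zm distr, of "\<lambda>x. \<bar>x - T (real b) x\<bar>" i] by (simp add: R_def)
    have indepY: "indep_vars (\<lambda>_. borel) Y UNIV"
      unfolding Y_def[abs_def] by (rule indep_vars_compose2[OF indep]) measurable
    have sqY: "integrable M (\<lambda>\<omega>. (Y i \<omega>)\<^sup>2)" for i
    proof (rule integrable_const_bound[where B = "(real b + \<bar>m\<bar>)\<^sup>2"])
      have "\<bar>Y i \<omega>\<bar> \<le> \<bar>real b + \<bar>m\<bar>\<bar>" for \<omega> by (auto simp: Y_def T_def)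
      then show "AE \<omega> in M. norm ((Y i \<omega>)\<^sup>2) \<le> (real b + \<bar>m\<bar>)\<^sup>2"
        unfolding abs_le_square_iff by simp
    qed simp
    have meanY: "expectation (Y i) = 0" for i
      using expectation_iid(2)[OF Zm Zm distr, of "T (real b)" i] intT
      by (simp add: Y_def[abs_def] m_def prob_space)
    have varY: "expectation (\<lambda>\<omega>. (Y i \<omega>)\<^sup>2) = s" for i
      using expectation_iid(2)[OF Zm Zm distr, of "\<lambda>x. (T (real b) x - m)\<^sup>2" i]
      by (simp add: Y_def s_def)
    note momY = second_moment_indep_sum[OF indepY sqY meanY varY]
    have EZ: "expectation (Z 0) = m + expectation (R 0)"
      unfolding R_def m_def using int intT by simp
    have absR0: "\<bar>expectation (R 0)\<bar> < e / 8"
      using integral_abs_bound[of M "R 0"] ER[of 0] by linarith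
    \<comment> \<open>Beyond \<open>n0\<close> the second-moment term \<open>s / (e * n)\<close> is
      at most \<open>e / 4\<close>. The use of \<open>Suc n0\<close> below makes
      \<open>n > 0\<close> immediate.\<close>
    obtain n0 :: nat where n0: "4 * s / e\<^sup>2 < real n0" using reals_Archimedean2 by blast
    show "\<exists>no. \<forall>n\<ge>no. norm (expectation (\<lambda>\<omega>. \<bar>(\<Sum>i<n. Z i \<omega>) / real n - expectation (Z 0)\<bar>) - 0) < e"
    proof (intro exI allI impI)
      fix n assume n: "n \<ge> Suc n0"
      define D where "D \<omega> = e / 4 + 1 / (e * (real n)\<^sup>2) * (\<Sum>i<n. Y i \<omega>)\<^sup>2
        + (1 / real n * (\<Sum>i<n. \<bar>R i \<omega>\<bar>) + e / 8)" for \<omega>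
      have intD: "integrable M D"
        unfolding D_def using momY(1) intR by simp
      have bound: "\<bar>(\<Sum>i<n. Z i \<omega>) / real n - expectation (Z 0)\<bar> \<le> D \<omega>" for \<omega>
      proof -
        have "(\<Sum>i<n. Z i \<omega>) = (\<Sum>i<n. Y i \<omega> + m + R i \<omega>)" by (simp add: Y_def R_def)
        also have "\<dots> = (\<Sum>i<n. Y i \<omega>) + real n * m + (\<Sum>i<n. R i \<omega>)"
          by (simp add: sum.distrib)
        finally have eq: "(\<Sum>i<n. Z i \<omega>) / real n - expectation (Z 0)
            = (\<Sum>i<n. Y i \<omega>) / real n + ((\<Sum>i<n. R i \<omega>) / real n - expectation (R 0))"
          using n EZ by (simp add: add_divide_distrib)
        \<comment> \<open>The square of \<open>\<bar>x\<bar> - e / 2\<close> is nonnegative; divided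
          by \<open>e\<close>, this trades the first moment of the truncated mean for its second
          moment.\<close>
        have "\<bar>x\<bar> \<le> e / 4 + 1 / e * x\<^sup>2" for x :: real
        proof -
          have "0 \<le> (\<bar>x\<bar> - e / 2)\<^sup>2" by simp
          then have "\<bar>x\<bar> * e \<le> e\<^sup>2 / 4 + x\<^sup>2" by (simp add: power2_diff power_divide)
          then have "\<bar>x\<bar> \<le> (e\<^sup>2 / 4 + x\<^sup>2) / e" using e by (simp add: pos_le_divide_eq)
          also have "\<dots> = e / 4 + 1 / e * x\<^sup>2"
            using e by (simp add: add_divide_distrib power2_eq_square)
          finally show ?thesis .
        qed
        from this[of "(\<Sum>i<n. Y i \<omega>) / real n"]
        have 1: "\<bar>(\<Sum>i<n. Y i \<omega>) / real n\<bar> \<le> e / 4 + 1 / (e * (real n)\<^sup>2) * (\<Sum>i<n. Y i \<omega>)\<^sup>2"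
          by (simp add: power_divide)
        have 2: "\<bar>(\<Sum>i<n. R i \<omega>) / real n\<bar> \<le> 1 / real n * (\<Sum>i<n. \<bar>R i \<omega>\<bar>)"
          using n by (simp add: divide_right_mono sum_abs)
        show ?thesis unfolding eq D_def using 1 2 absR0 by linarith
      qed
      have s0: "s \<ge> 0" unfolding s_def by simp
      have "expectation (\<lambda>\<omega>. \<bar>(\<Sum>i<n. Z i \<omega>) / real n - expectation (Z 0)\<bar>) \<le> expectation D"
        using bound int intD by (intro integral_mono) auto
      also have "expectation D = e / 4 + 1 / (e * (real n)\<^sup>2) * (real n * s)
          + (1 / real n * (\<Sum>i<n. expectation (\<lambda>\<omega>. \<bar>R i \<omega>\<bar>)) + e / 8)"
        unfolding D_def using momY intR by (simp add: prob_space)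
      also have "\<dots> \<le> e / 4 + e / 4 + (e / 8 + e / 8)"
      proof -
        have "4 * s / e\<^sup>2 \<le> real n" using n n0 by simp
        then have "1 / (e * (real n)\<^sup>2) * (real n * s) \<le> e / 4"
          using n e by (simp add: field_simps power2_eq_square)
        moreover have "(\<Sum>i<n. expectation (\<lambda>\<omega>. \<bar>R i \<omega>\<bar>)) \<le> (\<Sum>i<n. e / 8)"
          using ER by (intro sum_mono less_imp_le)
        then have "1 / real n * (\<Sum>i<n. expectation (\<lambda>\<omega>. \<bar>R i \<omega>\<bar>)) \<le> e / 8"
          using n by (simp add: field_simps)
        ultimately show ?thesis by linarith
      qed
      also have "\<dots> < e" using e by simp
      finally show "norm (expectation (\<lambda>\<omega>. \<bar>(\<Sum>i<n. Z i \<omega>) / real n - expectation (Z 0)\<bar>) - 0) < e"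
        by simp
    qed
  qed
qed

section \<open>Independence of the pairs of design row and error\<close>

text \<open>Events that constrain finitely many coordinates are cylinders in the generated
  \<sigma>-algebras. Independence of the two sequences is used only through this product
  formula.\<close>

lemma (in prob_space) indep_sequencesD:
  fixes X :: "nat \<Rightarrow> 'a \<Rightarrow> 'b::topological_space" and Y :: "nat \<Rightarrow> 'a \<Rightarrow> 'c::topological_space"
  assumes indep: "indep_sequences M X Y" and fin: "finite J"
    and A: "\<And>i. i \<in> J \<Longrightarrow> A i \<in> sets borel" and B: "\<And>i. i \<in> J \<Longrightarrow> B i \<in> sets borel"
  shows "prob ({\<omega> \<in> space M. \<forall>i\<in>J. X i \<omega> \<in> A i} \<inter> {\<omega> \<in> space M. \<forall>i\<in>J. Y i \<omega> \<in> B i}) =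
    prob {\<omega> \<in> space M. \<forall>i\<in>J. X i \<omega> \<in> A i} * prob {\<omega> \<in> space M. \<forall>i\<in>J. Y i \<omega> \<in> B i}"
proof -
  have cyl: "{\<omega> \<in> space M. \<forall>i\<in>J. V i \<omega> \<in> D i} \<in>
      sets (vimage_algebra (space M) (\<lambda>\<omega> i. V i \<omega>) (Pi\<^sub>M (UNIV::nat set) (\<lambda>_. borel)))"
    if "\<And>i. i \<in> J \<Longrightarrow> D i \<in> sets borel" for V :: "nat \<Rightarrow> 'a \<Rightarrow> 'd::topological_space" and D
  proof -
    let ?P = "Pi\<^sub>M (UNIV::nat set) (\<lambda>_. borel :: 'd measure)"
    have "{x \<in> space ?P. \<forall>i\<in>J. x i \<in> D i} \<in> sets ?P"
      using fin that by measurable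
    from in_vimage_algebra[OF this, of "\<lambda>\<omega> i. V i \<omega>" "space M"]
    have "(\<lambda>\<omega> i. V i \<omega>) -` {x \<in> space ?P. \<forall>i\<in>J. x i \<in> D i} \<inter> space M
      \<in> sets (vimage_algebra (space M) (\<lambda>\<omega> i. V i \<omega>) ?P)" .
    also have "(\<lambda>\<omega> i. V i \<omega>) -` {x \<in> space ?P. \<forall>i\<in>J. x i \<in> D i} \<inter> space M
        = {\<omega> \<in> space M. \<forall>i\<in>J. V i \<omega> \<in> D i}"
      by (auto simp: space_PiM)
    finally show ?thesis .
  qed
  show ?thesis
    using indep unfolding indep_sequences_def by (rule indep_setD) (rule cyl; use A B in blast)+
qed

text \<open>Rectangles generate the \<sigma>-algebra of a pair and are stable under intersection, so
  the product formula is checked on them. There the joint event splits into a cylinder for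
  \<open>X\<close> and one for \<open>Y\<close>, each factors over the indices, and factors of equal
  index recombine.\<close>

lemma (in prob_space) indep_vars_Pair:
  fixes X :: "nat \<Rightarrow> 'a \<Rightarrow> 'b::topological_space" and Y :: "nat \<Rightarrow> 'a \<Rightarrow> 'c::topological_space"
  assumes X: "indep_vars (\<lambda>_. borel) X UNIV" and Y: "indep_vars (\<lambda>_. borel) Y UNIV"
    and XY: "indep_sequences M X Y"
  shows "indep_vars (\<lambda>_. borel \<Otimes>\<^sub>M borel) (\<lambda>i \<omega>. (X i \<omega>, Y i \<omega>)) UNIV"
proof -
  have [measurable]: "X i \<in> borel_measurable M" "Y i \<in> borel_measurable M" for i
    using X Y unfolding indep_vars_def2 by simp_all
  define G where "G i = {{\<omega> \<in> space M. X i \<omega> \<in> A \<and> Y i \<omega> \<in> B} | A B. A \<in> sets borel \<and> B \<in> sets borel}" for i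
  have Gev: "G i \<subseteq> events" for i unfolding G_def by auto
  have stable: "Int_stable (G i)" for i
  proof (rule Int_stableI)
    fix a b assume "a \<in> G i" "b \<in> G i"
    then obtain A B A' B' where "a = {\<omega> \<in> space M. X i \<omega> \<in> A \<and> Y i \<omega> \<in> B}"
      "b = {\<omega> \<in> space M. X i \<omega> \<in> A' \<and> Y i \<omega> \<in> B'}" and m: "A \<in> sets borel" "B \<in> sets borel"
      "A' \<in> sets borel" "B' \<in> sets borel" unfolding G_def by blast
    then have "a \<inter> b = {\<omega> \<in> space M. X i \<omega> \<in> A \<inter> A' \<and> Y i \<omega> \<in> B \<inter> B'}" by auto
    with m show "a \<inter> b \<in> G i" unfolding G_def by blast
  qed
  have "indep_sets G UNIV"
  proof (rule indep_setsI)
    fix F J assume J: "J \<noteq> {}" "finite J" and F: "\<forall>j\<in>J. F j \<in> G j"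
    then have "\<forall>j\<in>J. \<exists>P. fst P \<in> sets borel \<and> snd P \<in> sets borel \<and>
        F j = {\<omega> \<in> space M. X j \<omega> \<in> fst P \<and> Y j \<omega> \<in> snd P}"
      unfolding G_def by fastforce
    from bchoice[OF this] obtain P where P: "\<And>j. j \<in> J \<Longrightarrow> fst (P j) \<in> sets borel \<and>
        snd (P j) \<in> sets borel \<and> F j = {\<omega> \<in> space M. X j \<omega> \<in> fst (P j) \<and> Y j \<omega> \<in> snd (P j)}"
      by blast
    define A where "A j = fst (P j)" for j
    define B where "B j = snd (P j)" for j
    have AB: "\<And>j. j \<in> J \<Longrightarrow> A j \<in> sets borel" "\<And>j. j \<in> J \<Longrightarrow> B j \<in> sets borel"
      and F': "\<And>j. j \<in> J \<Longrightarrow> F j = {\<omega> \<in> space M. X j \<omega> \<in> A j \<and> Y j \<omega> \<in> B j}"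
      using P unfolding A_def B_def by auto
    have one: "prob (F j) = prob {\<omega> \<in> space M. X j \<omega> \<in> A j} * prob {\<omega> \<in> space M. Y j \<omega> \<in> B j}"
      if "j \<in> J" for j
    proof -
      have "{\<omega> \<in> space M. X j \<omega> \<in> A j} \<inter> {\<omega> \<in> space M. Y j \<omega> \<in> B j}
          = {\<omega> \<in> space M. X j \<omega> \<in> A j \<and> Y j \<omega> \<in> B j}" by auto
      then show ?thesis
        using indep_sequencesD[OF XY, of "{j}" A B] AB that F' by simp
    qed
    have all: "prob {\<omega> \<in> space M. \<forall>j\<in>J. V j \<omega> \<in> D j} = (\<Prod>j\<in>J. prob {\<omega> \<in> space M. V j \<omega> \<in> D j})"
      if "indep_vars (\<lambda>_. borel) V UNIV" "\<And>j. j \<in> J \<Longrightarrow> D j \<in> sets borel"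
      for V :: "nat \<Rightarrow> 'a \<Rightarrow> 'd::topological_space" and D
    proof -
      have "(\<Inter>j\<in>J. V j -` D j \<inter> space M) = {\<omega> \<in> space M. \<forall>j\<in>J. V j \<omega> \<in> D j}" using J by auto
      moreover have "V j -` D j \<inter> space M = {\<omega> \<in> space M. V j \<omega> \<in> D j}" for j by auto
      ultimately show ?thesis
        using indep_varsD[OF that(1), of J D] J that(2) by simp
    qed
    have "(\<Inter>j\<in>J. F j) = {\<omega> \<in> space M. \<forall>j\<in>J. X j \<omega> \<in> A j} \<inter> {\<omega> \<in> space M. \<forall>j\<in>J. Y j \<omega> \<in> B j}"
      using F' J by auto
    then show "prob (\<Inter>j\<in>J. F j) = (\<Prod>j\<in>J. prob (F j))"
      using indep_sequencesD[OF XY J(2), of A B] AB one all[OF X, of A] all[OF Y, of B]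
      by (simp add: prod.distrib)
  qed (use Gev in auto)
  then have indepG: "indep_sets (\<lambda>i. sigma_sets (space M) (G i)) UNIV"
    using stable by (rule indep_sets_sigma)
  show ?thesis
    unfolding indep_vars_def2
  proof (intro conjI ballI)
    show "indep_sets (\<lambda>i. {(\<lambda>\<omega>. (X i \<omega>, Y i \<omega>)) -` A \<inter> space M |A. A \<in> sets (borel \<Otimes>\<^sub>M borel)}) UNIV"
    proof (rule indep_sets_mono_sets[OF indepG])
      fix i
      let ?S = "sigma (space M) (G i)"
      have sp: "space ?S = space M" using Gev sets.sets_into_space by (intro space_measure_of) blast
      have S: "sets ?S = sigma_sets (space M) (G i)" using Gev sets.sets_into_space by (intro sets_measure_of) blast
      have "X i \<in> borel_measurable ?S"
      proof (rule measurableI)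
        fix A :: "'b set" assume A: "A \<in> sets borel"
        have "X i -` A \<inter> space ?S = {\<omega> \<in> space M. X i \<omega> \<in> A \<and> Y i \<omega> \<in> UNIV}" unfolding sp by auto
        then show "X i -` A \<inter> space ?S \<in> sets ?S"
          unfolding S using A by (intro sigma_sets.Basic) (force simp: G_def)
      qed simp
      moreover have "Y i \<in> borel_measurable ?S"
      proof (rule measurableI)
        fix A :: "'c set" assume A: "A \<in> sets borel"
        have "Y i -` A \<inter> space ?S = {\<omega> \<in> space M. X i \<omega> \<in> UNIV \<and> Y i \<omega> \<in> A}" unfolding sp by auto
        then show "Y i -` A \<inter> space ?S \<in> sets ?S"
          unfolding S using A by (intro sigma_sets.Basic) (force simp: G_def)
      qed simp
      ultimately have "(\<lambda>\<omega>. (X i \<omega>, Y i \<omega>)) \<in> measurable ?S (borel \<Otimes>\<^sub>M borel)" by measurable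
      from measurable_sets[OF this]
      show "{(\<lambda>\<omega>. (X i \<omega>, Y i \<omega>)) -` A \<inter> space M |A. A \<in> sets (borel \<Otimes>\<^sub>M borel)}
          \<subseteq> sigma_sets (space M) (G i)" unfolding S sp by auto
    qed
  qed measurable
qed

section \<open>Trigonometric polynomials as test functions for weak convergence\<close>

text \<open>The free phase \<open>b\<close> puts sines and constants into the family, and the
  product-to-sum formula keeps it closed under multiplication. It is thus an algebra whose
  expectations are determined by those of single cosines.\<close>

inductive trig_polynomial :: "('v::euclidean_space \<Rightarrow> real) \<Rightarrow> bool" where
  cos: "trig_polynomial (\<lambda>x. c * cos (t \<bullet> x + b))"
| add: "trig_polynomial F \<Longrightarrow> trig_polynomial G \<Longrightarrow> trig_polynomial (\<lambda>x. F x + G x)"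

lemma trig_polynomial_const: "trig_polynomial (\<lambda>x. c)"
  using trig_polynomial.cos[of c 0 0] by simp

lemma trig_polynomial_sin: "trig_polynomial (\<lambda>x. c * sin (t \<bullet> x))"
  using trig_polynomial.cos[of c t "- pi / 2"] by (simp add: cos_diff)

lemma trig_polynomial_sum:
  assumes "finite A" "\<And>a. a \<in> A \<Longrightarrow> trig_polynomial (F a)"
  shows "trig_polynomial (\<lambda>x. \<Sum>a\<in>A. F a x)"
  using assms by (induction A) (auto intro: trig_polynomial.add trig_polynomial_const)

lemma trig_polynomial_mult:
  assumes "trig_polynomial F" "trig_polynomial G"
  shows "trig_polynomial (\<lambda>x. F x * G x)"
  using assms
proof (induction arbitrary: G rule: trig_polynomial.induct)
  case (cos c t b)
  from cos show ?case
  proof (induction rule: trig_polynomial.induct)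
    case (cos c' t' b')
    have "(\<lambda>x. c * cos (t \<bullet> x + b) * (c' * cos (t' \<bullet> x + b'))) =
        (\<lambda>x. c * c' / 2 * cos ((t - t') \<bullet> x + (b - b')) + c * c' / 2 * cos ((t + t') \<bullet> x + (b + b')))"
    proof
      fix x
      have "cos (t \<bullet> x + b) * cos (t' \<bullet> x + b') =
          (cos ((t - t') \<bullet> x + (b - b')) + cos ((t + t') \<bullet> x + (b + b'))) / 2"
        unfolding cos_times_cos by (simp add: inner_diff_left inner_add_left algebra_simps)
      moreover have "c * cos (t \<bullet> x + b) * (c' * cos (t' \<bullet> x + b')) =
          c * c' * (cos (t \<bullet> x + b) * cos (t' \<bullet> x + b'))" by simp
      ultimately show "c * cos (t \<bullet> x + b) * (c' * cos (t' \<bullet> x + b')) =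
          c * c' / 2 * cos ((t - t') \<bullet> x + (b - b')) + c * c' / 2 * cos ((t + t') \<bullet> x + (b + b'))"
        by (simp add: distrib_left add_divide_distrib)
    qed
    then show ?case by (simp only: trig_polynomial.add trig_polynomial.cos)
  next
    case (add F G)
    then show ?case by (simp only: distrib_left trig_polynomial.add)
  qed
next
  case (add F1 F2)
  then show ?case by (simp only: distrib_right trig_polynomial.add)
qed

lemma trig_polynomial_continuous: "trig_polynomial F \<Longrightarrow> continuous_on UNIV F"
  by (induction rule: trig_polynomial.induct) (auto intro!: continuous_intros)

lemma trig_polynomial_bounded: "trig_polynomial F \<Longrightarrow> \<exists>B. \<forall>x. \<bar>F x\<bar> \<le> B"
proof (induction rule: trig_polynomial.induct)
  case (cos c t b)
  have "\<bar>c * cos (t \<bullet> x + b)\<bar> \<le> \<bar>c\<bar>" for x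
    unfolding abs_mult by (rule mult_left_le) auto
  then show ?case by blast
next
  case (add F G)
  then obtain B B' where "\<And>x. \<bar>F x\<bar> \<le> B" "\<And>x. \<bar>G x\<bar> \<le> B'" by blast
  then have "\<bar>F x + G x\<bar> \<le> B + B'" for x
    using abs_triangle_ineq[of "F x" "G x"] by (meson add_mono order_trans)
  then show ?case by blast
qed

text \<open>On a cube of side \<open>\<pi> / \<delta>\<close> every continuous function is a continuous function of
  the vector of the \<open>sin (\<delta> x\<^sub>j)\<close>. A polynomial in these sines inherits the approximation
  on the cube and, the sines staying in \<open>[-1, 1]\<close>, the bound outside of it.\<close>

lemma trig_polynomial_approximation:
  fixes h :: "'v::euclidean_space \<Rightarrow> real"
  assumes cont: "continuous_on UNIV h" and bdd: "\<And>x. \<bar>h x\<bar> \<le> B" and e: "e > 0" and R: "R > 0"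
  obtains F where "trig_polynomial F" "\<And>x. \<bar>F x\<bar> \<le> B + e" "\<And>x. norm x \<le> R \<Longrightarrow> \<bar>F x - h x\<bar> \<le> e"
proof -
  \<comment> \<open>With this frequency, coordinates of size at most \<open>R\<close> are scaled
    into \<open>[- pi / 2, pi / 2]\<close>, where \<open>arcsin\<close> inverts \<open>sin\<close>;
    \<open>as\<close> below is then a left inverse of \<open>sn\<close> on the ball.\<close>
  define \<delta> where "\<delta> = pi / (2 * R)"
  have \<delta>: "\<delta> > 0" using R by (simp add: \<delta>_def)
  define sn where "sn x = (\<Sum>b\<in>Basis. sin ((\<delta> *\<^sub>R b) \<bullet> x) *\<^sub>R b)" for x :: 'v
  define as where "as z = (\<Sum>b\<in>Basis. (arcsin (z \<bullet> b) / \<delta>) *\<^sub>R b)" for z :: 'v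
  let ?K = "cbox (- One) One :: 'v set"
  have sn_b: "sn x \<bullet> b = sin ((\<delta> *\<^sub>R b) \<bullet> x)" if "b \<in> Basis" for x b
    unfolding sn_def using that by (simp add: inner_sum_left_Basis)
  have sn_K: "sn x \<in> ?K" for x
    by (simp add: mem_box sn_b)
  have as_sn: "as (sn x) = x" if "norm x \<le> R" for x
  proof (rule euclidean_eqI)
    fix b :: 'v assume b: "b \<in> Basis"
    have "\<bar>x \<bullet> b\<bar> \<le> R" using Basis_le_norm[OF b, of x] that by simp
    then have "\<delta> * \<bar>x \<bullet> b\<bar> \<le> \<delta> * R" using \<delta> by (intro mult_left_mono) auto
    then have "\<bar>\<delta> * (x \<bullet> b)\<bar> \<le> pi / 2" using R \<delta> by (simp add: abs_mult \<delta>_def)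
    then have "arcsin (sin (\<delta> * (x \<bullet> b))) = \<delta> * (x \<bullet> b)"
      by (intro arcsin_sin) (auto simp: abs_le_iff)
    then have "arcsin (sn x \<bullet> b) = \<delta> * (x \<bullet> b)"
      using b by (simp add: sn_b inner_commute[of b x])
    then show "as (sn x) \<bullet> b = x \<bullet> b"
      using b \<delta> unfolding as_def by (simp add: inner_sum_left_Basis)
  qed
  have "continuous_on ?K as"
    unfolding as_def
    by (intro continuous_intros) (use \<delta> in \<open>auto simp: mem_box\<close>)
  then have conth: "continuous_on ?K (\<lambda>z. h (as z))"
    using continuous_on_compose2[OF cont] by blast
  obtain g where g: "real_polynomial_function g" "\<And>z. z \<in> ?K \<Longrightarrow> \<bar>h (as z) - g z\<bar> < e"
    using Stone_Weierstrass_real_polynomial_function[OF compact_cbox conth e] by blast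
  have "trig_polynomial (\<lambda>x. g (sn x))"
    using g(1)
  proof (induction rule: real_polynomial_function.induct)
    case (linear f)
    then interpret bounded_linear f .
    have "(\<lambda>x. f (sn x)) = (\<lambda>x. \<Sum>b\<in>Basis. f b * sin ((\<delta> *\<^sub>R b) \<bullet> x))"
      unfolding sn_def by (simp only: sum scaleR real_scaleR_def mult.commute)
    then show ?case by (simp only: trig_polynomial_sum finite_Basis trig_polynomial_sin)
  qed (auto intro: trig_polynomial_const trig_polynomial.add trig_polynomial_mult)
  moreover have "\<bar>g (sn x)\<bar> \<le> B + e" for x
    using g(2)[OF sn_K[of x]] bdd[of "as (sn x)"] by linarith
  moreover have "\<bar>g (sn x) - h x\<bar> \<le> e" if "norm x \<le> R" for x
    using g(2)[OF sn_K[of x]] as_sn[OF that] by simp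
  ultimately show ?thesis using that by blast
qed

lemma trig_polynomial_expectation_tendsto:
  fixes Y :: "nat \<Rightarrow> 'a \<Rightarrow> 'v::euclidean_space" and W :: "'b \<Rightarrow> 'v"
  assumes "prob_space M" "prob_space N"
    and Y: "\<And>n. Y n \<in> borel_measurable M" and W: "W \<in> borel_measurable N"
    and cos: "\<And>t b. (\<lambda>n. \<integral>\<omega>. cos (t \<bullet> Y n \<omega> + b) \<partial>M) \<longlonglongrightarrow> (\<integral>\<omega>. cos (t \<bullet> W \<omega> + b) \<partial>N)"
    and F: "trig_polynomial F"
  shows "(\<lambda>n. \<integral>\<omega>. F (Y n \<omega>) \<partial>M) \<longlonglongrightarrow> (\<integral>\<omega>. F (W \<omega>) \<partial>N)"
proof -
  interpret M: prob_space M by fact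
  interpret N: prob_space N by fact
  have int: "integrable M (\<lambda>\<omega>. G (Y n \<omega>))" "integrable N (\<lambda>\<omega>. G (W \<omega>))" if G: "trig_polynomial G" for G n
  proof -
    obtain B where B: "\<And>x. \<bar>G x\<bar> \<le> B" using trig_polynomial_bounded[OF G] by blast
    have [measurable]: "G \<in> borel_measurable borel"
      using trig_polynomial_continuous[OF G] by (rule borel_measurable_continuous_onI)
    note [measurable] = Y W
    show "integrable M (\<lambda>\<omega>. G (Y n \<omega>))" by (rule M.integrable_const_bound[where B = B]) (auto simp: B)
    show "integrable N (\<lambda>\<omega>. G (W \<omega>))" by (rule N.integrable_const_bound[where B = B]) (auto simp: B)
  qed
  show ?thesis
    using F
  proof (induction rule: trig_polynomial.induct)
    case (cos c t b)
    show ?case by (simp add: tendsto_mult_left assms(5))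
  next
    case (add F G)
    then show ?case by (simp add: int tendsto_add)
  qed
qed

text \<open>\<open>h\<close> is replaced by a trigonometric polynomial that is close to it on a
  large ball and bounded outside. Tightness makes the outer part small uniformly in
  \<open>n\<close>; for the single law of \<open>W\<close> this is automatic.\<close>

theorem bounded_continuous_expectation_tendsto:
  fixes Y :: "nat \<Rightarrow> 'a \<Rightarrow> 'v::euclidean_space" and W :: "'b \<Rightarrow> 'v"
  assumes M: "prob_space M" and N: "prob_space N"
    and Y [measurable]: "\<And>n. Y n \<in> borel_measurable M" and W [measurable]: "W \<in> borel_measurable N"
    and cos: "\<And>t b. (\<lambda>n. \<integral>\<omega>. cos (t \<bullet> Y n \<omega> + b) \<partial>M) \<longlonglongrightarrow> (\<integral>\<omega>. cos (t \<bullet> W \<omega> + b) \<partial>N)"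
    and tight: "\<And>e. e > 0 \<Longrightarrow> \<exists>R. \<forall>n. measure M {\<omega> \<in> space M. norm (Y n \<omega>) > R} \<le> e"
    and h: "continuous_on UNIV h" and bdd: "\<And>x. \<bar>h x\<bar> \<le> (B::real)"
  shows "(\<lambda>n. \<integral>\<omega>. h (Y n \<omega>) \<partial>M) \<longlonglongrightarrow> (\<integral>\<omega>. h (W \<omega>) \<partial>N)"
proof (rule LIMSEQ_I)
  interpret M: prob_space M by fact
  interpret N: prob_space N by fact
  fix e :: real assume e: "e > 0"
  have B: "B \<ge> 0" using bdd[of 0] by linarith
  \<comment> \<open>For each law the replacement costs at most
    \<open>\<eta> + (2 * B + \<eta>) * \<eta>\<close>, hence at most
    \<open>\<eta> * (2 * B + 3) \<le> e / 4\<close> since \<open>\<eta> \<le> 1\<close>. With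
    \<open>e / 4\<close> for the convergence of the polynomial expectations the total stays below
    \<open>e\<close>.\<close>
  define \<eta> where "\<eta> = min 1 (e / 4 / (2 * B + 3))"
  have \<eta>: "\<eta> > 0" "\<eta> \<le> 1" using e B by (auto simp: \<eta>_def)
  have "\<eta> \<le> e / 4 / (2 * B + 3)" by (simp add: \<eta>_def)
  then have \<eta>e: "\<eta> * (2 * B + 3) \<le> e / 4"
    using B by (subst (asm) pos_le_divide_eq) auto
  obtain R1 where R1: "\<And>n. measure M {\<omega> \<in> space M. norm (Y n \<omega>) > R1} \<le> \<eta>"
    using tight[OF \<eta>(1)] by blast
  have "(\<lambda>k. measure N {\<omega> \<in> space N. norm (W \<omega>) > real k}) \<longlonglongrightarrow>
      measure N (\<Inter>k. {\<omega> \<in> space N. norm (W \<omega>) > real k})"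
    by (rule N.finite_Lim_measure_decseq) (auto simp: decseq_def)
  moreover have "(\<Inter>k. {\<omega> \<in> space N. norm (W \<omega>) > real k}) = {}"
  proof -
    have "\<exists>k. \<not> norm (W \<omega>) > real k" for \<omega>
      using real_arch_simple[of "norm (W \<omega>)"] by (simp add: not_less)
    then show ?thesis by blast
  qed
  ultimately have tailN: "(\<lambda>k. measure N {\<omega> \<in> space N. norm (W \<omega>) > real k}) \<longlonglongrightarrow> 0"
    by simp
  have "eventually (\<lambda>k. measure N {\<omega> \<in> space N. norm (W \<omega>) > real k} < \<eta>) sequentially"
    by (rule order_tendstoD(2)[OF tailN \<eta>(1)])
  then obtain R2 where R2: "measure N {\<omega> \<in> space N. norm (W \<omega>) > real R2} < \<eta>"
    by (auto simp: eventually_sequentially)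
  define R where "R = max 1 (max R1 (real R2))"
  have R: "R > 0" by (simp add: R_def)
  obtain F where F: "trig_polynomial F" and FB: "\<And>x. \<bar>F x\<bar> \<le> B + \<eta>"
    and Fh: "\<And>x. norm x \<le> R \<Longrightarrow> \<bar>F x - h x\<bar> \<le> \<eta>"
    using trig_polynomial_approximation[OF h bdd \<eta>(1) R] by blast
  have [measurable]: "h \<in> borel_measurable borel" "F \<in> borel_measurable borel"
    using h trig_polynomial_continuous[OF F] by (auto intro: borel_measurable_continuous_onI)
  have close: "\<bar>(\<integral>\<omega>. F (V \<omega>) \<partial>P) - (\<integral>\<omega>. h (V \<omega>) \<partial>P)\<bar> \<le> e / 4"
    if P: "prob_space P" and V [measurable]: "V \<in> borel_measurable P"
      and tail: "measure P {\<omega> \<in> space P. norm (V \<omega>) > R} \<le> \<eta>"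
    for P :: "'c measure" and V
  proof -
    interpret P: prob_space P by fact
    let ?A = "{\<omega> \<in> space P. norm (V \<omega>) > R}"
    have [measurable]: "?A \<in> sets P" by measurable
    have intF: "integrable P (\<lambda>\<omega>. F (V \<omega>))"
      by (rule P.integrable_const_bound[where B = "B + \<eta>"]) (auto simp: FB)
    have inth: "integrable P (\<lambda>\<omega>. h (V \<omega>))"
      by (rule P.integrable_const_bound[where B = B]) (auto simp: bdd)
    have pw: "\<bar>F (V \<omega>) - h (V \<omega>)\<bar> \<le> \<eta> + (2 * B + \<eta>) * indicator ?A \<omega>" if "\<omega> \<in> space P" for \<omega>
    proof (cases "norm (V \<omega>) > R")
      case True
      then show ?thesis using FB[of "V \<omega>"] bdd[of "V \<omega>"] \<eta> that by simp
    next
      case False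
      then show ?thesis using Fh[of "V \<omega>"] by simp
    qed
    have "\<bar>(\<integral>\<omega>. F (V \<omega>) \<partial>P) - (\<integral>\<omega>. h (V \<omega>) \<partial>P)\<bar> = \<bar>\<integral>\<omega>. F (V \<omega>) - h (V \<omega>) \<partial>P\<bar>"
      using intF inth by simp
    also have "\<dots> \<le> (\<integral>\<omega>. \<bar>F (V \<omega>) - h (V \<omega>)\<bar> \<partial>P)" by (rule integral_abs_bound)
    also have "\<dots> \<le> (\<integral>\<omega>. \<eta> + (2 * B + \<eta>) * indicator ?A \<omega> \<partial>P)"
      using intF inth pw by (intro integral_mono) (auto simp: P.emeasure_eq_measure)
    also have "\<dots> = \<eta> + (2 * B + \<eta>) * measure P ?A"
      by (simp add: P.prob_space P.emeasure_eq_measure)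
    also have "\<dots> \<le> \<eta> + (2 * B + 2) * \<eta>"
      using B \<eta> tail by (intro add_left_mono mult_mono) auto
    also have "\<dots> = \<eta> * (2 * B + 3)" by (simp add: algebra_simps)
    finally show ?thesis using \<eta>e by linarith
  qed
  have closeM: "\<bar>(\<integral>\<omega>. F (Y n \<omega>) \<partial>M) - (\<integral>\<omega>. h (Y n \<omega>) \<partial>M)\<bar> \<le> e / 4" for n
  proof (rule close[OF M Y])
    have "measure M {\<omega> \<in> space M. norm (Y n \<omega>) > R} \<le> measure M {\<omega> \<in> space M. norm (Y n \<omega>) > R1}"
      by (intro M.finite_measure_mono) (auto simp: R_def)
    then show "measure M {\<omega> \<in> space M. norm (Y n \<omega>) > R} \<le> \<eta>" using R1[of n] by linarith
  qed
  have closeN: "\<bar>(\<integral>\<omega>. F (W \<omega>) \<partial>N) - (\<integral>\<omega>. h (W \<omega>) \<partial>N)\<bar> \<le> e / 4"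
  proof (rule close[OF N W])
    have "measure N {\<omega> \<in> space N. norm (W \<omega>) > R} \<le> measure N {\<omega> \<in> space N. norm (W \<omega>) > real R2}"
      by (intro N.finite_measure_mono) (auto simp: R_def)
    then show "measure N {\<omega> \<in> space N. norm (W \<omega>) > R} \<le> \<eta>" using R2 by linarith
  qed
  obtain n0 where n0: "\<And>n. n \<ge> n0 \<Longrightarrow> norm ((\<integral>\<omega>. F (Y n \<omega>) \<partial>M) - (\<integral>\<omega>. F (W \<omega>) \<partial>N)) < e / 4"
    using LIMSEQ_D[OF trig_polynomial_expectation_tendsto[OF M N Y W cos F], of "e / 4"] e by auto
  show "\<exists>no. \<forall>n\<ge>no. norm ((\<integral>\<omega>. h (Y n \<omega>) \<partial>M) - (\<integral>\<omega>. h (W \<omega>) \<partial>N)) < e"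
  proof (intro exI allI impI)
    fix n assume "n \<ge> n0"
    from n0[OF this] closeM[of n] closeN e
    show "norm ((\<integral>\<omega>. h (Y n \<omega>) \<partial>M) - (\<integral>\<omega>. h (W \<omega>) \<partial>N)) < e"
      unfolding real_norm_def by linarith
  qed
qed

section \<open>The score and the Gram matrix of the linear model\<close>

lemma normal_law_eq_distr:
  assumes "s > 0"
  shows "normal_law 0 s = distr std_normal_distribution borel (\<lambda>x. sqrt s * x)"
proof -
  interpret P: prob_space std_normal_distribution
    by (rule prob_space_normal_density) simp
  have "distributed std_normal_distribution lborel (\<lambda>x. x) (normal_density 0 1)"
    unfolding distributed_def by (auto simp: distr_id2)
  from P.normal_density_affine[OF this, of "sqrt s" 0] assms
  have "distr std_normal_distribution lborel (\<lambda>x. sqrt s * x)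
      = density lborel (\<lambda>x. ennreal (normal_density 0 (sqrt s) x))"
    by (simp add: distributed_def)
  moreover have "distr std_normal_distribution lborel (\<lambda>x. sqrt s * x)
      = distr std_normal_distribution borel (\<lambda>x. sqrt s * x)"
    by (rule distr_cong) auto
  ultimately show ?thesis using assms by (simp add: normal_law_def)
qed

text \<open>Scale and phase are moved into the test function \<open>cos (sqrt s * x + b)\<close>, so
  that the standard normal limit of the normalized sums applies as it stands.\<close>

lemma (in prob_space) central_limit_theorem_cos:
  fixes Z :: "nat \<Rightarrow> 'a \<Rightarrow> real"
  assumes indep: "indep_vars (\<lambda>_. borel) Z UNIV"
    and distr: "\<And>i. distr M borel (Z i) = distr M borel (Z 0)"
    and sq: "\<And>i. integrable M (\<lambda>\<omega>. (Z i \<omega>)\<^sup>2)"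
    and mean: "\<And>i. expectation (Z i) = 0"
    and var: "\<And>i. expectation (\<lambda>\<omega>. (Z i \<omega>)\<^sup>2) = s" and s: "s > 0"
  shows "(\<lambda>n. expectation (\<lambda>\<omega>. cos ((\<Sum>i<n. Z i \<omega>) / sqrt (real n) + b)))
    \<longlonglongrightarrow> (\<integral>x. cos (x + b) \<partial>normal_law 0 s)"
proof -
  have [measurable]: "Z i \<in> borel_measurable M" for i
    using indep unfolding indep_vars_def2 by simp
  define S where "S n \<omega> = (\<Sum>i<n. Z i \<omega>) / sqrt (real n * (sqrt s)\<^sup>2)" for n \<omega>
  have [measurable]: "S n \<in> borel_measurable M" for n unfolding S_def by measurable
  have "weak_conv_m (\<lambda>n. distr M borel (S n)) std_normal_distribution"
    unfolding S_def
    by (rule central_limit_theorem_zero_mean[OF indep mean _ sq _ distr]) (use mean var s in auto)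
  moreover have "isCont (\<lambda>x. cos (sqrt s * x + b)) x" for x by simp
  ultimately have "(\<lambda>n. \<integral>x. cos (sqrt s * x + b) \<partial>distr M borel (S n))
      \<longlonglongrightarrow> (\<integral>x. cos (sqrt s * x + b) \<partial>std_normal_distribution)"
    by (intro weak_conv_imp_integral_bdd_continuous_conv[where B = 1] real_distribution_distr
        real_dist_normal_dist) auto
  moreover have "(\<integral>x. cos (sqrt s * x + b) \<partial>distr M borel (S n))
      = expectation (\<lambda>\<omega>. cos ((\<Sum>i<n. Z i \<omega>) / sqrt (real n) + b))" for n
    using s by (simp add: integral_distr S_def real_sqrt_mult)
  moreover have "(\<integral>x. cos (sqrt s * x + b) \<partial>std_normal_distribution) = (\<integral>x. cos (x + b) \<partial>normal_law 0 s)"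
    unfolding normal_law_eq_distr[OF s] by (subst integral_distr) auto
  ultimately show ?thesis by simp
qed

text \<open>Preimages under \<open>\<phi>\<close> and \<open>\<psi>\<close> turn the generating
  events into cylinders over the single index \<open>i\<close>. With real-valued
  \<open>\<phi>\<close> and \<open>\<psi>\<close> this yields the moments of products of design and
  error.\<close>

lemma (in prob_space) indep_var_of_indep_sequences:
  fixes X :: "nat \<Rightarrow> 'a \<Rightarrow> 'b::topological_space" and Y :: "nat \<Rightarrow> 'a \<Rightarrow> 'c::topological_space"
  assumes indep: "indep_sequences M X Y"
    and [measurable]: "X i \<in> borel_measurable M" "Y i \<in> borel_measurable M"
    and [measurable]: "\<phi> \<in> measurable borel L" "\<psi> \<in> measurable borel L'"
  shows "indep_var L (\<lambda>\<omega>. \<phi> (X i \<omega>)) L' (\<lambda>\<omega>. \<psi> (Y i \<omega>))"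
  unfolding indep_var_eq
proof (intro conjI)
  let ?F = "{(\<lambda>\<omega>. \<phi> (X i \<omega>)) -` A \<inter> space M |A. A \<in> sets L}"
  let ?G = "{(\<lambda>\<omega>. \<psi> (Y i \<omega>)) -` A \<inter> space M |A. A \<in> sets L'}"
  show "random_variable L (\<lambda>\<omega>. \<phi> (X i \<omega>))" "random_variable L' (\<lambda>\<omega>. \<psi> (Y i \<omega>))"
    by measurable
  have "indep_set ?F ?G"
  proof (rule indep_setI)
    fix a b assume "a \<in> ?F" "b \<in> ?G"
    then obtain A B where ab: "a = (\<lambda>\<omega>. \<phi> (X i \<omega>)) -` A \<inter> space M" "b = (\<lambda>\<omega>. \<psi> (Y i \<omega>)) -` B \<inter> space M"
      and AB: "A \<in> sets L" "B \<in> sets L'" by blast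
    have m: "\<phi> -` A \<in> sets borel" "\<psi> -` B \<in> sets borel"
      using measurable_sets[OF assms(4) AB(1)] measurable_sets[OF assms(5) AB(2)] by auto
    have "a = {\<omega> \<in> space M. \<forall>j\<in>{i}. X j \<omega> \<in> \<phi> -` A}" "b = {\<omega> \<in> space M. \<forall>j\<in>{i}. Y j \<omega> \<in> \<psi> -` B}"
      using ab by auto
    then show "prob (a \<inter> b) = prob a * prob b"
      using indep_sequencesD[OF indep, of "{i}" "\<lambda>_. \<phi> -` A" "\<lambda>_. \<psi> -` B"] m by simp
  qed auto
  then show "indep_set (sigma_sets (space M) ?F) (sigma_sets (space M) ?G)"
  proof (rule indep_set_sigma_sets)
    show "Int_stable ?F"
    proof (rule Int_stableI)
      fix a b assume "a \<in> ?F" "b \<in> ?F"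
      then obtain A B where "a = (\<lambda>\<omega>. \<phi> (X i \<omega>)) -` A \<inter> space M" "b = (\<lambda>\<omega>. \<phi> (X i \<omega>)) -` B \<inter> space M"
        "A \<in> sets L" "B \<in> sets L" by blast
      then show "a \<inter> b \<in> ?F" by (auto intro!: exI[of _ "A \<inter> B"])
    qed
    show "Int_stable ?G"
    proof (rule Int_stableI)
      fix a b assume "a \<in> ?G" "b \<in> ?G"
      then obtain A B where "a = (\<lambda>\<omega>. \<psi> (Y i \<omega>)) -` A \<inter> space M" "b = (\<lambda>\<omega>. \<psi> (Y i \<omega>)) -` B \<inter> space M"
        "A \<in> sets L'" "B \<in> sets L'" by blast
      then show "a \<inter> b \<in> ?G" by (auto intro!: exI[of _ "A \<inter> B"])
    qed
  qed
qed

lemma borel_measurable_vec_nth [measurable (raw)]: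
  fixes Y :: "'a \<Rightarrow> real ^ 'p"
  assumes "Y \<in> borel_measurable M"
  shows "(\<lambda>\<omega>. Y \<omega> $ j) \<in> borel_measurable M"
  by (rule borel_measurable_continuous_on[OF _ assms]) (intro continuous_intros)

lemma centered_with_covariance_square:
  fixes Y :: "'a \<Rightarrow> real ^ 'p"
  assumes cov: "centered_with_covariance M Y C"
  shows "integrable M (\<lambda>\<omega>. Y \<omega> $ j * Y \<omega> $ k)"
    and "integrable M (\<lambda>\<omega>. (t \<bullet> Y \<omega>)\<^sup>2)"
    and "(\<integral>\<omega>. (t \<bullet> Y \<omega>)\<^sup>2 \<partial>M) = t \<bullet> (C *v t)"
    and "(\<integral>\<omega>. t \<bullet> Y \<omega> \<partial>M) = 0"
proof -
  have [measurable]: "Y \<in> borel_measurable M" and int: "integrable M Y"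
    and sq: "integrable M (\<lambda>\<omega>. (norm (Y \<omega>))\<^sup>2)" and mean: "(\<integral>\<omega>. Y \<omega> \<partial>M) = 0"
    and C: "\<And>j k. C $ j $ k = (\<integral>\<omega>. Y \<omega> $ j * Y \<omega> $ k \<partial>M)"
    using cov unfolding centered_with_covariance_def by auto
  have prod: "integrable M (\<lambda>\<omega>. Y \<omega> $ j * Y \<omega> $ k)" for j k
  proof (rule Bochner_Integration.integrable_bound[OF sq])
    show "AE \<omega> in M. norm (Y \<omega> $ j * Y \<omega> $ k) \<le> norm ((norm (Y \<omega>))\<^sup>2)"
      by (auto simp: abs_mult power2_eq_square component_le_norm_cart intro!: mult_mono)
  qed measurable
  then show "integrable M (\<lambda>\<omega>. Y \<omega> $ j * Y \<omega> $ k)" .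
  have eq: "(t \<bullet> Y \<omega>)\<^sup>2 = (\<Sum>j\<in>UNIV. \<Sum>k\<in>UNIV. t $ j * t $ k * (Y \<omega> $ j * Y \<omega> $ k))" for \<omega>
    by (simp add: inner_vec_def power2_eq_square sum_product mult_ac)
  show "integrable M (\<lambda>\<omega>. (t \<bullet> Y \<omega>)\<^sup>2)" unfolding eq using prod by simp
  have "(\<integral>\<omega>. (t \<bullet> Y \<omega>)\<^sup>2 \<partial>M) = (\<Sum>j\<in>UNIV. \<Sum>k\<in>UNIV. t $ j * t $ k * C $ j $ k)"
    unfolding eq using prod by (simp add: C)
  also have "\<dots> = t \<bullet> (C *v t)"
    by (simp add: inner_vec_def matrix_vector_mult_def sum_distrib_left mult_ac)
  finally show "(\<integral>\<omega>. (t \<bullet> Y \<omega>)\<^sup>2 \<partial>M) = t \<bullet> (C *v t)" .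
  show "(\<integral>\<omega>. t \<bullet> Y \<omega> \<partial>M) = 0" using int mean by simp
qed

definition gram_matrix :: "nat \<Rightarrow> (nat \<Rightarrow> real ^ 'p) \<Rightarrow> real ^ 'p ^ 'p" where
  "gram_matrix n x = (\<chi> j k. (\<Sum>i<n. x i $ j * x i $ k) / real n)"

text \<open>This is \<open>X\<^sup>T \<epsilon> / sqrt n\<close>, the linear term that appears when
  the squares are expanded about the true parameter.\<close>

definition score :: "nat \<Rightarrow> (nat \<Rightarrow> real ^ 'p) \<Rightarrow> (nat \<Rightarrow> real) \<Rightarrow> real ^ 'p" where
  "score n x \<epsilon> = (1 / sqrt (real n)) *\<^sub>R (\<Sum>i<n. \<epsilon> i *\<^sub>R x i)"

text \<open>Every linear functional of the score is a normalized sum of scalars, which reduces the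
  vector-valued limit to dimension one.\<close>

lemma inner_score: "t \<bullet> score n x \<epsilon> = (\<Sum>i<n. (t \<bullet> x i) * \<epsilon> i) / sqrt (real n)"
  by (simp add: score_def inner_sum_right mult.commute)

lemma norm_matrix_le_sum:
  fixes A :: "real ^ 'p ^ 'q"
  shows "norm A \<le> (\<Sum>j\<in>UNIV. \<Sum>k\<in>UNIV. \<bar>A $ j $ k\<bar>)"
proof -
  have "norm A \<le> (\<Sum>j\<in>UNIV. norm (A $ j))"
    unfolding norm_vec_def by (rule L2_set_le_sum) simp
  also have "\<dots> \<le> (\<Sum>j\<in>UNIV. \<Sum>k\<in>UNIV. \<bar>A $ j $ k\<bar>)"
    by (intro sum_mono norm_le_l1_cart)
  finally show ?thesis .
qed

locale linear_model = prob_space M for M :: "'a measure" +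
  fixes X :: "nat \<Rightarrow> 'a \<Rightarrow> real ^ 'p" and eps :: "nat \<Rightarrow> 'a \<Rightarrow> real"
    and C :: "real ^ 'p ^ 'p" and \<sigma> :: real
  assumes X_iid: "iid M borel X"
    and X_cov: "\<And>i. centered_with_covariance M (X i) C"
    and C: "pos_def_matrix C"
    and eps_iid: "iid M borel eps"
    and eps_var: "\<And>i. centered_with_variance M (eps i) (\<sigma>\<^sup>2)"
    and \<sigma>: "\<sigma>\<^sup>2 > 0"
    and indep: "indep_sequences M X eps"
begin

lemma measurable_X [measurable]: "X i \<in> borel_measurable M"
  using X_cov unfolding centered_with_covariance_def by blast

lemma measurable_eps [measurable]: "eps i \<in> borel_measurable M"
  using eps_var unfolding centered_with_variance_def by blast

lemma measurable_score [measurable]: "(\<lambda>\<omega>. score n (\<lambda>i. X i \<omega>) (\<lambda>i. eps i \<omega>)) \<in> borel_measurable M"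
  unfolding score_def by measurable

lemma measurable_gram_matrix_component [measurable]:
  "(\<lambda>\<omega>. gram_matrix n (\<lambda>i. X i \<omega>) $ j $ k) \<in> borel_measurable M"
  unfolding gram_matrix_def by simp

lemma summands:
  defines "Z t i \<omega> \<equiv> (t \<bullet> X i \<omega>) * eps i \<omega>"
  shows "indep_vars (\<lambda>_. borel) (Z t) UNIV"
    and "distr M borel (Z t i) = distr M borel (Z t 0)"
    and "integrable M (\<lambda>\<omega>. (Z t i \<omega>)\<^sup>2)"
    and "expectation (Z t i) = 0"
    and "expectation (\<lambda>\<omega>. (Z t i \<omega>)\<^sup>2) = t \<bullet> ((\<sigma>\<^sup>2 *\<^sub>R C) *v t)"
proof -
  have iv: "indep_vars (\<lambda>_. borel) X UNIV" "indep_vars (\<lambda>_. borel) eps UNIV"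
    and dX: "distr M borel (X i) = distr M borel (X 0)"
    and de: "distr M borel (eps i) = distr M borel (eps 0)" for i
    using X_iid eps_iid unfolding iid_def by auto
  show "indep_vars (\<lambda>_. borel) (Z t) UNIV"
    unfolding Z_def
    using indep_vars_compose2[OF indep_vars_Pair[OF iv indep],
        of "\<lambda>_ p. (t \<bullet> fst p) * snd p" "\<lambda>_. borel"] by simp
  have ind: "indep_var borel (\<lambda>\<omega>. t \<bullet> X i \<omega>) borel (eps i)" for i
    by (rule indep_var_of_indep_sequences[OF indep]) measurable
  have ind2: "indep_var borel (\<lambda>\<omega>. (t \<bullet> X i \<omega>)\<^sup>2) borel (\<lambda>\<omega>. (eps i \<omega>)\<^sup>2)"
    by (rule indep_var_of_indep_sequences[OF indep]) measurable
  \<comment> \<open>By independence the law of the product is the image of the product of the two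
    marginal laws, neither of which depends on \<open>i\<close>.\<close>
  have "distr M borel (Z t i) = distr (distr (distr M borel (X i)) borel ((\<bullet>) t) \<Otimes>\<^sub>M distr M borel (eps i))
      borel (\<lambda>p. fst p * snd p)" for i
  proof -
    have "distr (distr M borel (X i)) borel ((\<bullet>) t) = distr M borel (\<lambda>\<omega>. t \<bullet> X i \<omega>)"
      by (subst distr_distr) (auto simp: comp_def)
    then have "distr (distr M borel (X i)) borel ((\<bullet>) t) \<Otimes>\<^sub>M distr M borel (eps i)
        = distr M (borel \<Otimes>\<^sub>M borel) (\<lambda>\<omega>. (t \<bullet> X i \<omega>, eps i \<omega>))"
      using ind[of i] unfolding indep_var_distribution_eq by simp
    then show ?thesis
      by (simp add: distr_distr comp_def Z_def[abs_def])
  qed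
  from this[of i] this[of 0]
  show "distr M borel (Z t i) = distr M borel (Z t 0)" by (simp add: dX[of i] de[of i])
  have e: "integrable M (eps i)" "integrable M (\<lambda>\<omega>. (eps i \<omega>)\<^sup>2)" "expectation (eps i) = 0"
    "expectation (\<lambda>\<omega>. (eps i \<omega>)\<^sup>2) = \<sigma>\<^sup>2"
    using eps_var[of i] unfolding centered_with_variance_def by auto
  note x = centered_with_covariance_square[OF X_cov[of i]]
  have intX: "integrable M (\<lambda>\<omega>. t \<bullet> X i \<omega>)"
    by (rule square_integrable_imp_integrable[OF _ x(2)]) measurable
  show "expectation (Z t i) = 0"
    unfolding Z_def using indep_var_lebesgue_integral[OF ind intX e(1)] by (simp add: e)
  show "integrable M (\<lambda>\<omega>. (Z t i \<omega>)\<^sup>2)"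
    unfolding Z_def power_mult_distrib by (rule indep_var_integrable[OF ind2 x(2) e(2)])
  show "expectation (\<lambda>\<omega>. (Z t i \<omega>)\<^sup>2) = t \<bullet> ((\<sigma>\<^sup>2 *\<^sub>R C) *v t)"
    unfolding Z_def power_mult_distrib
    using indep_var_lebesgue_integral[OF ind2 x(2) e(2)] x(3)[of t]
    by (simp add: e scaleR_matrix_vector_assoc[symmetric])
qed

lemma score_cos_tendsto:
  fixes W :: "'b \<Rightarrow> real ^ 'p"
  assumes N: "prob_space N" and W: "multivariate_normal N W 0 (\<sigma>\<^sup>2 *\<^sub>R C)"
  shows "(\<lambda>n. expectation (\<lambda>\<omega>. cos (t \<bullet> score n (\<lambda>i. X i \<omega>) (\<lambda>i. eps i \<omega>) + b)))
    \<longlonglongrightarrow> (\<integral>\<omega>. cos (t \<bullet> W \<omega> + b) \<partial>N)"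
\<comment> \<open>For \<open>t = 0\<close> the limit law is a point mass, while the central limit
  theorem needs positive variance; both expectations are then \<open>cos b\<close>.\<close>
proof (cases "t = 0")
  case True
  interpret N: prob_space N by fact
  show ?thesis using True by (simp add: prob_space N.prob_space)
next
  case False
  have [measurable]: "W \<in> borel_measurable N"
    and law: "distr N borel (\<lambda>\<omega>. t \<bullet> W \<omega>) = normal_law 0 (t \<bullet> ((\<sigma>\<^sup>2 *\<^sub>R C) *v t))"
    using W unfolding multivariate_normal_def by auto
  have "t \<bullet> ((\<sigma>\<^sup>2 *\<^sub>R C) *v t) > 0"
    using C \<sigma> False by (simp add: pos_def_matrix_def scaleR_matrix_vector_assoc[symmetric])
  from central_limit_theorem_cos[OF summands this, of b]
  have "(\<lambda>n. expectation (\<lambda>\<omega>. cos (t \<bullet> score n (\<lambda>i. X i \<omega>) (\<lambda>i. eps i \<omega>) + b)))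
      \<longlonglongrightarrow> (\<integral>x. cos (x + b) \<partial>distr N borel (\<lambda>\<omega>. t \<bullet> W \<omega>))"
    unfolding inner_score law .
  then show ?thesis by (simp add: integral_distr)
qed

lemma score_tight:
  assumes e: "e > 0"
  shows "\<exists>R. \<forall>n. prob {\<omega> \<in> space M. norm (score n (\<lambda>i. X i \<omega>) (\<lambda>i. eps i \<omega>)) > R} \<le> e"
proof -
  define Y where "Y n \<omega> = score n (\<lambda>i. X i \<omega>) (\<lambda>i. eps i \<omega>)" for n \<omega>
  have [measurable]: "Y n \<in> borel_measurable M" for n unfolding Y_def by measurable
  define K where "K = (\<Sum>b\<in>Basis. b \<bullet> ((\<sigma>\<^sup>2 *\<^sub>R C) *v b))"
  \<comment> \<open>An inequality because the score is 0 at \<open>n = 0\<close>; for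
    \<open>n > 0\<close> equality holds.\<close>
  have mom: "integrable M (\<lambda>\<omega>. (b \<bullet> Y n \<omega>)\<^sup>2) \<and>
      expectation (\<lambda>\<omega>. (b \<bullet> Y n \<omega>)\<^sup>2) \<le> b \<bullet> ((\<sigma>\<^sup>2 *\<^sub>R C) *v b)" for b n
  proof -
    note m = second_moment_indep_sum[OF summands(1,3,4,5)[of b], of n]
    have eq: "(b \<bullet> Y n \<omega>)\<^sup>2 = (\<Sum>i<n. (b \<bullet> X i \<omega>) * eps i \<omega>)\<^sup>2 / real n" for \<omega>
      by (simp add: Y_def inner_score power_divide)
    have "0 \<le> expectation (\<lambda>\<omega>. ((b \<bullet> X 0 \<omega>) * eps 0 \<omega>)\<^sup>2)" by simp
    then have "0 \<le> b \<bullet> ((\<sigma>\<^sup>2 *\<^sub>R C) *v b)" unfolding summands(5) .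
    then show ?thesis unfolding eq using m by simp
  qed
  have normsq: "(norm (Y n \<omega>))\<^sup>2 = (\<Sum>b\<in>Basis. (b \<bullet> Y n \<omega>)\<^sup>2)" for n \<omega>
    unfolding power2_norm_eq_inner
    by (subst euclidean_inner) (simp add: power2_eq_square inner_commute)
  have int: "integrable M (\<lambda>\<omega>. (norm (Y n \<omega>))\<^sup>2)" for n unfolding normsq using mom by simp
  have K: "expectation (\<lambda>\<omega>. (norm (Y n \<omega>))\<^sup>2) \<le> K" for n
    unfolding normsq K_def using mom by (simp add: sum_mono)
  \<comment> \<open>The radius for Markov's inequality, given a second moment of at most
    \<open>K\<close>; the summand 1 keeps it positive.\<close>
  define R where "R = sqrt ((\<bar>K\<bar> + 1) / e)"
  have R: "R\<^sup>2 = (\<bar>K\<bar> + 1) / e" "R > 0" using e by (auto simp: R_def intro!: divide_pos_pos)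
  have "prob {\<omega> \<in> space M. norm (Y n \<omega>) > R} \<le> e" for n
  proof -
    have "prob {\<omega> \<in> space M. norm (Y n \<omega>) > R} \<le> prob {\<omega> \<in> space M. (norm (Y n \<omega>))\<^sup>2 \<ge> R\<^sup>2}"
      using R(2) by (intro finite_measure_mono) (auto intro!: power_mono)
    also have "\<dots> \<le> expectation (\<lambda>\<omega>. (norm (Y n \<omega>))\<^sup>2) / R\<^sup>2"
      using R(2) by (intro integral_Markov_inequality_measure[where A = "{}"] int) auto
    also have "\<dots> \<le> (\<bar>K\<bar> + 1) / R\<^sup>2" using K[of n] by (intro divide_right_mono) auto
    also have "\<dots> = e" unfolding R using e by simp
    finally show ?thesis .
  qed
  then show ?thesis unfolding Y_def by blast
qed

lemma score_expectation_tendsto: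
  fixes W :: "'b \<Rightarrow> real ^ 'p"
  assumes N: "prob_space N" and W: "multivariate_normal N W 0 (\<sigma>\<^sup>2 *\<^sub>R C)"
    and h: "continuous_on UNIV h" "\<And>x. \<bar>h x\<bar> \<le> (B::real)"
  shows "(\<lambda>n. expectation (\<lambda>\<omega>. h (score n (\<lambda>i. X i \<omega>) (\<lambda>i. eps i \<omega>)))) \<longlonglongrightarrow> (\<integral>\<omega>. h (W \<omega>) \<partial>N)"
proof (rule bounded_continuous_expectation_tendsto[OF prob_space_axioms N _ _ _ _ h])
  show "W \<in> borel_measurable N" using W by (simp add: multivariate_normal_def)
qed (auto intro: score_cos_tendsto[OF N W] score_tight)

text \<open>The weak law gives convergence of each entry in mean, and Markov's inequality the rest.
  Measuring the distance by the sum over the entries keeps it a finite sum of integrable functions;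
  \<open>norm_matrix_le_sum\<close> passes to the norm.\<close>

lemma gram_matrix_tendsto:
  assumes \<delta>: "\<delta> > 0"
  shows "(\<lambda>n. prob {\<omega> \<in> space M. (\<Sum>j\<in>UNIV. \<Sum>k\<in>UNIV. \<bar>(gram_matrix n (\<lambda>i. X i \<omega>) - C) $ j $ k\<bar>) \<ge> \<delta>}) \<longlonglongrightarrow> 0"
proof -
  define D where "D n \<omega> = (\<Sum>j\<in>UNIV. \<Sum>k\<in>UNIV. \<bar>(gram_matrix n (\<lambda>i. X i \<omega>) - C) $ j $ k\<bar>)" for n \<omega>
  have iv: "indep_vars (\<lambda>_. borel) X UNIV"
    and dX: "distr M borel (X i) = distr M borel (X 0)" for i
    using X_iid unfolding iid_def by auto
  have int: "integrable M (\<lambda>\<omega>. X i \<omega> $ j * X i \<omega> $ k)" for i j k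
    by (rule centered_with_covariance_square[OF X_cov])
  have intG: "integrable M (\<lambda>\<omega>. gram_matrix n (\<lambda>i. X i \<omega>) $ j $ k)" for n j k
    unfolding gram_matrix_def using int by simp
  have entry: "(\<lambda>n. expectation (\<lambda>\<omega>. \<bar>(gram_matrix n (\<lambda>i. X i \<omega>) - C) $ j $ k\<bar>)) \<longlonglongrightarrow> 0" for j k
  proof -
    let ?Z = "\<lambda>i \<omega>. X i \<omega> $ j * X i \<omega> $ k"
    have ind: "indep_vars (\<lambda>_. borel) ?Z UNIV"
      by (rule indep_vars_compose2[OF iv]) measurable
    have dist: "distr M borel (?Z i) = distr M borel (?Z 0)" for i
    proof -
      have "distr M borel (?Z i) = distr (distr M borel (X i)) borel (\<lambda>x. x $ j * x $ k)" for i
        by (subst distr_distr) (auto simp: comp_def)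
      then show ?thesis using dX[of i] by simp
    qed
    have "C $ j $ k = expectation (?Z 0)"
      using X_cov[of 0] unfolding centered_with_covariance_def by blast
    then show ?thesis
      using weak_law_of_large_numbers_L1[OF ind dist int] by (simp add: gram_matrix_def)
  qed
  have D_nonneg: "D n \<omega> \<ge> 0" for n \<omega> unfolding D_def by (simp add: sum_nonneg)
  have intD: "integrable M (D n)" for n unfolding D_def using intG by simp
  have "(\<lambda>n. \<Sum>j\<in>UNIV. \<Sum>k\<in>UNIV. expectation (\<lambda>\<omega>. \<bar>(gram_matrix n (\<lambda>i. X i \<omega>) - C) $ j $ k\<bar>))
      \<longlonglongrightarrow> (\<Sum>j\<in>(UNIV::'p set). \<Sum>k\<in>(UNIV::'p set). 0)"
    by (intro tendsto_sum entry)
  moreover have "expectation (D n)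
      = (\<Sum>j\<in>UNIV. \<Sum>k\<in>UNIV. expectation (\<lambda>\<omega>. \<bar>(gram_matrix n (\<lambda>i. X i \<omega>) - C) $ j $ k\<bar>))" for n
    unfolding D_def using intG by simp
  ultimately have "(\<lambda>n. expectation (D n)) \<longlonglongrightarrow> 0" by simp
  then have lim: "(\<lambda>n. expectation (D n) / \<delta>) \<longlonglongrightarrow> 0" by (rule tendsto_divide_zero)
  have bound: "prob {\<omega> \<in> space M. D n \<omega> \<ge> \<delta>} \<le> expectation (D n) / \<delta>" for n
    by (rule integral_Markov_inequality_measure[where A = "{}"]) (use intD \<delta> in \<open>auto simp: D_nonneg\<close>)
  have "(\<lambda>n. prob {\<omega> \<in> space M. D n \<omega> \<ge> \<delta>}) \<longlonglongrightarrow> 0"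
    by (rule tendsto_sandwich[OF always_eventually always_eventually tendsto_const lim])
      (simp_all add: bound)
  then show ?thesis unfolding D_def .
qed

end

section \<open>Perturbation of penalized quadratic minimization\<close>

lemma is_minimizer_iff: "is_minimizer F b \<longleftrightarrow> (\<forall>y. F b \<le> (F y :: real))"
  by (auto simp: is_minimizer_def is_arg_min_def not_less)

text \<open>The norm of this type is the Frobenius norm; Cauchy-Schwarz is applied row by
  row.\<close>

lemma norm_matrix_vector_mult_le:
  fixes A :: "real ^ 'p ^ 'q"
  shows "norm (A *v x) \<le> norm A * norm x"
proof -
  have "norm (A *v x) = L2_set (\<lambda>i. \<bar>A $ i \<bullet> x\<bar>) UNIV"
    by (simp add: norm_vec_def matrix_vector_mul_component)
  also have "\<dots> \<le> L2_set (\<lambda>i. norm (A $ i) * norm x) UNIV"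
    by (intro L2_set_mono Cauchy_Schwarz_ineq2) auto
  also have "\<dots> = norm A * norm x"
    by (simp add: L2_set_left_distrib norm_vec_def[of A])
  finally show ?thesis .
qed

lemma tendsto_matrix_vector_mult [tendsto_intros]:
  fixes A :: "'a \<Rightarrow> real ^ 'p ^ 'q"
  assumes "(A \<longlongrightarrow> B) F" "(x \<longlongrightarrow> z) F"
  shows "((\<lambda>k. A k *v x k) \<longlongrightarrow> B *v z) F"
  by (rule vec_tendstoI) (auto simp: matrix_vector_mul_component intro!: tendsto_intros assms)

text \<open>The form attains a positive minimum on the unit sphere, namely the smallest eigenvalue
  of \<open>C\<close>, and homogeneity extends the bound.\<close>

lemma pos_def_matrix_lower_bound:
  fixes C :: "real ^ 'p ^ 'p"
  assumes "pos_def_matrix C"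
  obtains \<kappa> where "\<kappa> > 0" "\<And>u. \<kappa> * (norm u)\<^sup>2 \<le> u \<bullet> (C *v u)"
proof -
  have "compact (sphere (0::real^'p) 1)" "sphere (0::real^'p) 1 \<noteq> {}" by auto
  moreover have "continuous_on (sphere 0 1) (\<lambda>u. u \<bullet> (C *v u))"
    unfolding continuous_on_def by (auto intro!: tendsto_intros)
  ultimately have "\<exists>z\<in>sphere 0 1. \<forall>u\<in>sphere 0 1. z \<bullet> (C *v z) \<le> u \<bullet> (C *v u)"
    by (rule continuous_attains_inf)
  then obtain z where z: "z \<in> sphere 0 1"
    and min: "\<And>u. u \<in> sphere 0 1 \<Longrightarrow> z \<bullet> (C *v z) \<le> u \<bullet> (C *v u)" by blast
  have "z \<noteq> 0" using z by auto
  then have pos: "z \<bullet> (C *v z) > 0" using assms unfolding pos_def_matrix_def by blast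
  moreover have "z \<bullet> (C *v z) * (norm u)\<^sup>2 \<le> u \<bullet> (C *v u)" for u
  proof (cases "u = 0")
    case False
    then have "z \<bullet> (C *v z) \<le> (inverse (norm u) *\<^sub>R u) \<bullet> (C *v (inverse (norm u) *\<^sub>R u))"
      by (intro min) simp
    also have "\<dots> = (u \<bullet> (C *v u)) / (norm u)\<^sup>2"
      by (simp add: matrix_vector_mult_scaleR power2_eq_square divide_inverse)
    finally show ?thesis using False by (simp add: field_simps)
  qed simp
  ultimately show ?thesis using that by blast
qed

text \<open>Half of the coercivity constant pays for the perturbation. The random objectives are
  thereby coercive with one constant for all matrices near \<open>C\<close>.\<close>

lemma quadratic_form_perturbation:
  fixes A C :: "real ^ 'p ^ 'p"
  assumes C: "\<And>u. \<kappa> * (norm u)\<^sup>2 \<le> u \<bullet> (C *v u)" and A: "norm (A - C) \<le> \<kappa> / 2"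
  shows "\<kappa> / 2 * (norm u)\<^sup>2 \<le> u \<bullet> (A *v u)"
proof -
  have "\<bar>u \<bullet> ((A - C) *v u)\<bar> \<le> norm u * (norm (A - C) * norm u)"
    by (rule order_trans[OF Cauchy_Schwarz_ineq2]) (intro mult_left_mono norm_matrix_vector_mult_le; simp)
  also have "\<dots> \<le> norm u * (\<kappa> / 2 * norm u)"
    using A by (intro mult_left_mono mult_right_mono) auto
  finally have "\<bar>u \<bullet> ((A - C) *v u)\<bar> \<le> \<kappa> / 2 * (norm u)\<^sup>2" by (simp add: power2_eq_square mult_ac)
  moreover have "u \<bullet> (A *v u) = u \<bullet> (C *v u) + u \<bullet> ((A - C) *v u)"
    by (simp add: matrix_vector_mult_diff_rdistrib inner_diff_right)
  ultimately show ?thesis using C[of u] by linarith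
qed

text \<open>One form for both problems: \<open>\<psi>\<close> is \<open>increment b r\<close> for
  the finite sample and \<open>directional b\<close> for the limit.\<close>

definition quadratic_objective ::
  "real ^ 'p ^ 'p \<Rightarrow> real ^ 'p \<Rightarrow> (real ^ 'p \<Rightarrow> real) \<Rightarrow> real ^ 'p \<Rightarrow> real" where
  "quadratic_objective A w \<psi> u = 1 / 2 * (u \<bullet> (A *v u)) - u \<bullet> w + \<psi> u"

text \<open>Beyond this radius \<open>\<kappa> / 2 * (norm u)\<^sup>2\<close> exceeds both linear
  terms. In the applications \<open>s\<close> is a subgradient of the penalty at the true parameter,
  so the radius does not depend on \<open>r\<close>.\<close>

lemma quadratic_objective_sublevel:
  assumes \<kappa>: "\<kappa> > 0" and A: "\<And>u. \<kappa> * (norm u)\<^sup>2 \<le> u \<bullet> (A *v u)"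
    and \<psi>: "\<And>u. s \<bullet> u \<le> \<psi> u" and u: "quadratic_objective A w \<psi> u \<le> 0"
  shows "norm u \<le> 2 * (norm w + norm s) / \<kappa>"
proof (rule ccontr)
  assume "\<not> ?thesis"
  then have gt: "norm u > 2 * (norm w + norm s) / \<kappa>" by simp
  have pos: "norm u > 0" by (rule le_less_trans[OF _ gt]) (use \<kappa> in simp)
  have "u \<bullet> w \<le> norm u * norm w" by (rule norm_cauchy_schwarz)
  moreover have "s \<bullet> u \<ge> - (norm u * norm s)"
    using Cauchy_Schwarz_ineq2[of s u] by (simp add: mult.commute abs_le_iff)
  moreover have "norm u * (2 * (norm w + norm s)) < norm u * (\<kappa> * norm u)"
    using gt \<kappa> pos by (intro mult_strict_left_mono) (auto simp: divide_less_eq mult.commute)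
  ultimately have "quadratic_objective A w \<psi> u > 0"
    unfolding quadratic_objective_def using A[of u] \<psi>[of u]
    by (simp add: algebra_simps power2_eq_square)
  then show False using u by simp
qed

lemma quadratic_objective_minimizer_bound:
  assumes "\<kappa> > 0" "\<And>u. \<kappa> * (norm u)\<^sup>2 \<le> u \<bullet> (A *v u)" "\<And>u. s \<bullet> u \<le> \<psi> u" and \<psi>0: "\<psi> 0 = 0"
    and min: "is_minimizer (quadratic_objective A w \<psi>) u"
  shows "norm u \<le> 2 * (norm w + norm s) / \<kappa>"
proof -
  have "quadratic_objective A w \<psi> u \<le> quadratic_objective A w \<psi> 0"
    using min by (simp add: is_minimizer_iff)
  then show ?thesis
    using quadratic_objective_sublevel[OF assms(1-3)] \<psi>0 by (simp add: quadratic_objective_def)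
qed

lemma quadratic_objective_has_minimizer:
  assumes \<kappa>: "\<kappa> > 0" "\<And>u. \<kappa> * (norm u)\<^sup>2 \<le> u \<bullet> (A *v u)" "\<And>u. s \<bullet> u \<le> \<psi> u" and \<psi>0: "\<psi> 0 = 0"
    and cont: "continuous_on UNIV \<psi>"
  shows "\<exists>u. is_minimizer (quadratic_objective A w \<psi>) u"
proof -
  let ?Q = "quadratic_objective A w \<psi>" and ?B = "cball 0 (2 * (norm w + norm s) / \<kappa>)"
  have 0: "0 \<in> ?B" using \<kappa> by simp
  have Q0: "?Q 0 = 0" using \<psi>0 by (simp add: quadratic_objective_def)
  have "(?Q \<longlongrightarrow> ?Q x) (at x)" for x
    unfolding quadratic_objective_def using cont
    by (auto intro!: tendsto_intros simp: continuous_on_def)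
  then have "continuous_on ?B ?Q"
    by (intro continuous_at_imp_continuous_on) (simp add: continuous_at)
  then have "\<exists>u\<in>?B. \<forall>y\<in>?B. ?Q u \<le> ?Q y"
    using 0 by (intro continuous_attains_inf) auto
  then obtain u where u: "u \<in> ?B" "\<And>y. y \<in> ?B \<Longrightarrow> ?Q u \<le> ?Q y" by blast
  have "?Q u \<le> ?Q y" for y
  proof (cases "y \<in> ?B")
    case False
    then have "\<not> norm y \<le> 2 * (norm w + norm s) / \<kappa>" by simp
    then have "\<not> ?Q y \<le> 0" using quadratic_objective_sublevel[OF \<kappa>(1-3), of w y] by blast
    then show ?thesis using u(2)[OF 0] Q0 by linarith
  qed (rule u(2))
  then show ?thesis unfolding is_minimizer_iff by blast
qed

text \<open>Midpoint convexity of \<open>\<psi>\<close> is enough: testing the minimizer against the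
  midpoint of \<open>u\<close> and \<open>x\<close> leaves a quarter of the quadratic form.\<close>

lemma quadratic_objective_growth:
  assumes mid: "\<And>x z. \<psi> ((1 / 2) *\<^sub>R (x + z)) \<le> (\<psi> x + \<psi> z) / 2"
    and min: "is_minimizer (quadratic_objective A w \<psi>) u"
  shows "quadratic_objective A w \<psi> u + (x - u) \<bullet> (A *v (x - u)) / 4 \<le> quadratic_objective A w \<psi> x"
proof -
  let ?Q = "quadratic_objective A w \<psi>"
  have "?Q u \<le> ?Q ((1 / 2) *\<^sub>R (u + x))" using min by (simp add: is_minimizer_iff)
  also have "\<dots> \<le> (?Q u + ?Q x) / 2 - (x - u) \<bullet> (A *v (x - u)) / 8"
    \<comment> \<open>parallelogram law\<close>
    using mid[of u x] unfolding quadratic_objective_def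
    by (simp add: matrix_vector_mult_scaleR matrix_vector_right_distrib matrix_vector_mult_diff_distrib
        inner_add_left inner_add_right inner_diff_left inner_diff_right field_simps)
  finally show ?thesis by (simp add: field_simps)
qed

section \<open>Max-linear penalties and their directional derivatives\<close>

lemma pattern_subset: "pattern S v x \<subseteq> S"
  by (auto simp: pattern_def argmax_set_def)

lemma argmax_set_nonempty:
  assumes "finite A" "A \<noteq> {}"
  shows "argmax_set A h \<noteq> {}"
proof -
  have "Max (h ` A) \<in> h ` A" using assms by (intro Max_in) auto
  then obtain i where "i \<in> A" "h i = Max (h ` A)" by force
  then have "i \<in> argmax_set A h" using assms by (simp add: argmax_set_def)
  then show ?thesis by blast
qed

lemma Max_image_eq_argmax:
  assumes "finite A" "i \<in> argmax_set A h"
  shows "Max (h ` A) = h i"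
  using assms by (intro Max_eqI) (auto simp: argmax_set_def)

lemma continuous_on_Max_image:
  assumes "finite A" "A \<noteq> {}" "\<And>i. i \<in> A \<Longrightarrow> continuous_on T (h i)"
  shows "continuous_on T (\<lambda>x. Max ((\<lambda>i. h i x :: real) ` A))"
  using assms
proof (induction rule: finite_ne_induct)
  case (insert i A)
  then show ?case by (simp add: Max_insert) (intro continuous_on_max; simp)
qed simp

lemma gderiv_directional:
  fixes g :: "'v::real_inner \<Rightarrow> real"
  assumes "GDERIV g x :> d"
  shows "((\<lambda>t. (g (x + t *\<^sub>R u) - g x) / t) \<longlongrightarrow> d \<bullet> u) (at_right 0)"
proof -
  have "((\<lambda>t. x + t *\<^sub>R u) has_derivative (\<lambda>t. t *\<^sub>R u)) (at (0::real))"
    by (auto intro!: derivative_eq_intros)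
  moreover have "(g has_derivative (\<lambda>h. h \<bullet> d)) (at (x + 0 *\<^sub>R u))"
    using assms by (simp add: gderiv_def)
  ultimately have "((\<lambda>t. g (x + t *\<^sub>R u)) has_derivative (\<lambda>t. (t *\<^sub>R u) \<bullet> d)) (at 0)"
    using has_derivative_compose by blast
  then have "((\<lambda>t. g (x + t *\<^sub>R u)) has_field_derivative (d \<bullet> u)) (at 0)"
    by (simp add: has_field_derivative_def inner_commute mult_commute_abs)
  then have "((\<lambda>t. (g (x + t *\<^sub>R u) - g x) / t) \<longlongrightarrow> d \<bullet> u) (at 0)"
    by (simp add: has_field_derivative_iff)
  then show ?thesis by (simp add: filterlim_at_split)
qed

lemma convex_gradient_inequality:
  fixes g :: "'v::real_inner \<Rightarrow> real"
  assumes conv: "convex_on UNIV g" and deriv: "GDERIV g x :> d"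
  shows "g x + d \<bullet> (z - x) \<le> g z"
proof -
  have lim: "((\<lambda>t. (g (x + t *\<^sub>R (z - x)) - g x) / t) \<longlongrightarrow> d \<bullet> (z - x)) (at_right 0)"
    by (rule gderiv_directional[OF deriv])
  have "eventually (\<lambda>t::real. t < 1) (at_right 0)"
    by (rule order_tendstoD(2)[OF tendsto_ident_at]) simp
  then have "eventually (\<lambda>t. (g (x + t *\<^sub>R (z - x)) - g x) / t \<le> g z - g x) (at_right 0)"
    using eventually_at_right_less[of "0::real"]
  proof eventually_elim
    case (elim t)
    have "g (x + t *\<^sub>R (z - x)) = g ((1 - t) *\<^sub>R x + t *\<^sub>R z)" by (simp add: algebra_simps)
    also have "\<dots> \<le> (1 - t) * g x + t * g z"
      using conv elim by (intro convex_onD) auto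
    finally have "g (x + t *\<^sub>R (z - x)) - g x \<le> (g z - g x) * t" by (simp add: algebra_simps)
    then show ?case using elim by (simp only: pos_divide_le_eq)
  qed
  then have "d \<bullet> (z - x) \<le> g z - g x"
    by (rule tendsto_upperbound[OF lim]) simp
  then show ?thesis by linarith
qed

locale max_linear_penalty =
  fixes f g :: "real ^ 'p \<Rightarrow> real" and S :: "'i set" and v :: "'i \<Rightarrow> real ^ 'p"
    and G :: "real ^ 'p \<Rightarrow> real ^ 'p"
  assumes finite_S: "finite S" and S_nonempty: "S \<noteq> {}"
    and convex_g: "convex_on UNIV g" and gradient: "\<And>x. GDERIV g x :> G x"
    and continuous_G: "continuous_on UNIV G"
    and f_eq: "\<And>x. f x = Max ((\<lambda>i. v i \<bullet> x) ` S) + g x"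
begin

lemma finite_pattern: "finite (pattern S v x)"
  using pattern_subset finite_S by (rule finite_subset)

lemma pattern_nonempty: "pattern S v x \<noteq> {}"
  unfolding pattern_def using finite_S S_nonempty by (rule argmax_set_nonempty)

lemma limiting_pattern_subset: "limiting_pattern S v x u \<subseteq> pattern S v x"
  by (auto simp: limiting_pattern_def argmax_set_def)

lemma limiting_pattern_nonempty: "limiting_pattern S v x u \<noteq> {}"
  unfolding limiting_pattern_def using finite_pattern pattern_nonempty by (rule argmax_set_nonempty)

lemma f_eq_pattern: "i \<in> pattern S v x \<Longrightarrow> f x = v i \<bullet> x + g x"
  unfolding f_eq pattern_def using Max_image_eq_argmax[OF finite_S] by metis

lemma f_ge: "i \<in> S \<Longrightarrow> v i \<bullet> x + g x \<le> f x"
  unfolding f_eq using finite_S by simp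

text \<open>The support function of the subdifferential of \<open>f\<close> at \<open>x\<close>,
  that is, of the convex hull of the vectors \<open>v i + G x\<close> with \<open>i\<close> in the
  pattern. It is the closed form of \<open>dir_deriv f x\<close> used from here on.\<close>

definition directional :: "real ^ 'p \<Rightarrow> real ^ 'p \<Rightarrow> real" where
  "directional x u = Max ((\<lambda>i. v i \<bullet> u) ` pattern S v x) + G x \<bullet> u"

lemma directional_eq: "i \<in> limiting_pattern S v x u \<Longrightarrow> directional x u = v i \<bullet> u + G x \<bullet> u"
  unfolding directional_def limiting_pattern_def using Max_image_eq_argmax[OF finite_pattern] by metis

lemma directional_ge: "i \<in> pattern S v x \<Longrightarrow> (v i + G x) \<bullet> u \<le> directional x u"
  unfolding directional_def using finite_pattern by (simp add: inner_add_left)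

text \<open>An index of the limiting pattern attains the maximum both at \<open>x\<close> and at
  \<open>x + t *\<^sub>R u\<close> for small \<open>t > 0\<close>, so along the ray the maximum
  reduces to one linear function.\<close>

lemma tendsto_directional: "((\<lambda>t. (f (x + t *\<^sub>R u) - f x) / t) \<longlongrightarrow> directional x u) (at_right 0)"
proof -
  obtain i where i: "i \<in> limiting_pattern S v x u" using limiting_pattern_nonempty by blast
  then have ix: "i \<in> pattern S v x" using limiting_pattern_subset by blast
  have "eventually (\<lambda>t. v i \<bullet> u + (g (x + t *\<^sub>R u) - g x) / t = (f (x + t *\<^sub>R u) - f x) / t) (at_right 0)"
    using eventually_pattern_eq_limiting_pattern[OF finite_S, of v x u] eventually_at_right_less
  proof eventually_elim
    case (elim t)
    then have "f (x + t *\<^sub>R u) = v i \<bullet> (x + t *\<^sub>R u) + g (x + t *\<^sub>R u)"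
      using i by (intro f_eq_pattern) simp
    then show ?case using elim f_eq_pattern[OF ix] by (simp add: inner_add_right field_simps)
  qed
  moreover have "((\<lambda>t. v i \<bullet> u + (g (x + t *\<^sub>R u) - g x) / t) \<longlongrightarrow> v i \<bullet> u + G x \<bullet> u) (at_right 0)"
    by (intro tendsto_intros gderiv_directional gradient)
  ultimately show ?thesis unfolding directional_eq[OF i] by (rule Lim_transform_eventually[rotated])
qed

lemma dir_deriv_eq: "dir_deriv f x u = directional x u"
  unfolding dir_deriv_def by (rule tendsto_Lim[OF _ tendsto_directional]) simp

text \<open>A linear piece active at \<open>x\<close>, together with the tangent of
  \<open>g\<close>, minorizes \<open>f\<close>. This one-sided bound takes the place of uniform
  convergence of the increments, both in bounding the minimizers and in passing to the
  limit.\<close>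

lemma directional_le: "t > 0 \<Longrightarrow> directional x u \<le> (f (x + t *\<^sub>R u) - f x) / t"
proof -
  assume t: "t > 0"
  obtain i where i: "i \<in> limiting_pattern S v x u" using limiting_pattern_nonempty by blast
  then have ix: "i \<in> pattern S v x" using limiting_pattern_subset by blast
  have "v i \<bullet> (x + t *\<^sub>R u) + g (x + t *\<^sub>R u) \<le> f (x + t *\<^sub>R u)"
    by (rule f_ge[OF subsetD[OF pattern_subset ix]])
  moreover have "g x + G x \<bullet> (x + t *\<^sub>R u - x) \<le> g (x + t *\<^sub>R u)"
    by (rule convex_gradient_inequality[OF convex_g gradient])
  ultimately have "t * directional x u \<le> f (x + t *\<^sub>R u) - f x"
    unfolding directional_eq[OF i] f_eq_pattern[OF ix] by (simp add: inner_add_right algebra_simps)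
  then show ?thesis using t by (simp add: pos_le_divide_eq mult.commute)
qed

lemma directional_zero: "directional x 0 = 0"
proof -
  obtain i where "i \<in> limiting_pattern S v x 0" using limiting_pattern_nonempty by blast
  from directional_eq[OF this] show ?thesis by simp
qed

lemma directional_midpoint:
  "directional x ((1 / 2) *\<^sub>R (u + z)) \<le> (directional x u + directional x z) / 2"
proof -
  obtain i where i: "i \<in> limiting_pattern S v x ((1 / 2) *\<^sub>R (u + z))"
    using limiting_pattern_nonempty by blast
  then have "i \<in> pattern S v x" using limiting_pattern_subset by blast
  from directional_ge[OF this, of u] directional_ge[OF this, of z] show ?thesis
    unfolding directional_eq[OF i] by (simp add: inner_add_left inner_add_right field_simps)
qed

lemma continuous_directional: "continuous_on UNIV (directional x)"
  unfolding directional_def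
  by (intro continuous_intros continuous_on_Max_image finite_pattern pattern_nonempty)

lemma continuous_f: "continuous_on UNIV f"
proof -
  have "continuous_on UNIV g" by (rule convex_on_continuous[OF open_UNIV convex_g])
  moreover have "continuous_on UNIV (\<lambda>x. Max ((\<lambda>i. v i \<bullet> x) ` S))"
    by (intro continuous_intros continuous_on_Max_image finite_S S_nonempty)
  ultimately have "continuous_on UNIV (\<lambda>x. Max ((\<lambda>i. v i \<bullet> x) ` S) + g x)" by (intro continuous_intros)
  then show ?thesis by (simp only: f_eq[symmetric])
qed

definition increment :: "real ^ 'p \<Rightarrow> real \<Rightarrow> real ^ 'p \<Rightarrow> real" where
  "increment x r u = (f (x + r *\<^sub>R u) - f x) / r"

lemma increment_zero: "increment x r 0 = 0"
  by (simp add: increment_def)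

lemma continuous_increment: "continuous_on UNIV (increment x r)"
proof -
  have "continuous_on UNIV (\<lambda>u. f (x + r *\<^sub>R u))"
    by (rule continuous_on_compose2[OF continuous_f]) (intro continuous_intros subset_UNIV)+
  then show ?thesis unfolding increment_def divide_inverse by (intro continuous_intros)
qed

end

section \<open>First-order conditions, ties and generic scores\<close>

lemma symmetric_matrix_inner:
  fixes A :: "real ^ 'p ^ 'p"
  assumes "transpose A = A"
  shows "x \<bullet> (A *v z) = z \<bullet> (A *v x)"
proof -
  have "x \<bullet> (A *v z) = (x v* A) \<bullet> z" by (simp add: dot_lmul_matrix)
  also have "x v* A = A *v x" by (metis assms transpose_matrix_vector)
  finally show ?thesis by (simp add: inner_commute)
qed

context max_linear_penalty
begin

text \<open>First-order condition with the directional derivative taken at the estimated point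
  \<open>b + r *\<^sub>R u\<close> and not at \<open>b\<close>, so that the current pattern
  enters.\<close>

lemma minimizer_variational_inequality:
  assumes sym: "transpose A = A" and r: "r > 0"
    and min: "is_minimizer (quadratic_objective A w (increment b r)) u"
  shows "0 \<le> d \<bullet> (A *v u) - d \<bullet> w + directional (b + r *\<^sub>R u) d"
proof -
  let ?x = "b + r *\<^sub>R u" and ?Q = "quadratic_objective A w (increment b r)"
  \<comment> \<open>The difference quotient of the objective for a step \<open>t\<close> along
    \<open>d\<close>, written in \<open>s = r * t\<close>, the step that the unscaled parameter
    makes.\<close>
  let ?D = "\<lambda>s. d \<bullet> (A *v u) - d \<bullet> w + (s / r) * (d \<bullet> (A *v d)) / 2 + (f (?x + s *\<^sub>R d) - f ?x) / s"
  have lim: "(?D \<longlongrightarrow> d \<bullet> (A *v u) - d \<bullet> w + (0 / r) * (d \<bullet> (A *v d)) / 2 + directional ?x d) (at_right 0)"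
    using r by (intro tendsto_intros tendsto_directional) auto
  have "eventually (\<lambda>s. 0 \<le> ?D s) (at_right 0)"
    using eventually_at_right_less
  proof eventually_elim
    case (elim s)
    define t where "t = s / r"
    have s: "s = r * t" and t: "t > 0" using elim r by (auto simp: t_def)
    have arg: "b + r *\<^sub>R (u + t *\<^sub>R d) = ?x + s *\<^sub>R d" by (simp add: s algebra_simps)
    have inc: "increment b r (u + t *\<^sub>R d) = increment b r u + (f (?x + s *\<^sub>R d) - f ?x) / r"
      unfolding increment_def arg by (simp add: diff_divide_distrib)
    have "?Q (u + t *\<^sub>R d) - ?Q u
        = t * (d \<bullet> (A *v u) - d \<bullet> w) + t\<^sup>2 * (d \<bullet> (A *v d)) / 2 + (f (?x + s *\<^sub>R d) - f ?x) / r"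
      unfolding quadratic_objective_def inc
      by (simp add: matrix_vector_mult_scaleR matrix_vector_right_distrib inner_add_left inner_add_right
          symmetric_matrix_inner[OF sym, of u d] power2_eq_square right_diff_distrib distrib_left add_divide_distrib)
    moreover have "0 \<le> ?Q (u + t *\<^sub>R d) - ?Q u" using min by (simp add: is_minimizer_iff)
    moreover have "t * ?D s = t * (d \<bullet> (A *v u) - d \<bullet> w) + t\<^sup>2 * (d \<bullet> (A *v d)) / 2 + (f (?x + s *\<^sub>R d) - f ?x) / r"
      using t r unfolding s by (simp add: field_simps power2_eq_square)
    ultimately have "0 \<le> t * ?D s" by simp
    then show ?case using t by (simp only: zero_le_mult_iff) auto
  qed
  then have "0 \<le> d \<bullet> (A *v u) - d \<bullet> w + (0 / r) * (d \<bullet> (A *v d)) / 2 + directional ?x d"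
    by (intro tendsto_lowerbound[OF lim]) auto
  then show ?thesis by simp
qed

text \<open>The points tied on \<open>q\<close> form the orthogonal complement of the differences
  \<open>v i - v j\<close> with \<open>i\<close> and \<open>j\<close> in \<open>q\<close>; it
  contains every point with pattern \<open>q\<close>.\<close>

definition tied :: "'i set \<Rightarrow> real ^ 'p \<Rightarrow> bool" where
  "tied q x \<longleftrightarrow> (\<forall>i\<in>q. \<forall>j\<in>q. v i \<bullet> x = v j \<bullet> x)"

lemma subspace_tied: "subspace {x. tied q x}"
proof (rule subspaceI)
  show "0 \<in> {x. tied q x}" by (simp add: tied_def)
  show "x + z \<in> {x. tied q x}" if "x \<in> {x. tied q x}" "z \<in> {x. tied q x}" for x z
    using that unfolding tied_def mem_Collect_eq inner_add_right by metis
  show "c *\<^sub>R x \<in> {x. tied q x}" if "x \<in> {x. tied q x}" for c x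
    using that unfolding tied_def mem_Collect_eq inner_scaleR_right by metis
qed

lemma tied_pattern: "tied (pattern S v x) x"
  unfolding tied_def pattern_def argmax_set_def by (intro ballI antisym) blast+

lemma tied_limiting_pattern: "tied (limiting_pattern S v x u) u"
  unfolding tied_def limiting_pattern_def argmax_set_def by (intro ballI antisym) blast+

text \<open>In directions that keep the ties of the current pattern the directional derivative is
  linear, so the variational inequalities for \<open>d\<close> and \<open>- d\<close> combine to an
  equation.\<close>

lemma minimizer_stationary:
  assumes sym: "transpose A = A" and r: "r > 0"
    and min: "is_minimizer (quadratic_objective A w (increment b r)) u"
    and d: "tied (pattern S v (b + r *\<^sub>R u)) d" and i: "i \<in> pattern S v (b + r *\<^sub>R u)"
  shows "d \<bullet> (w - A *v u - G (b + r *\<^sub>R u) - v i) = 0"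
proof -
  let ?x = "b + r *\<^sub>R u"
  have dir: "directional ?x e = (v i + G ?x) \<bullet> e" if "tied (pattern S v ?x) e" for e
  proof -
    have "\<forall>j\<in>pattern S v ?x. v j \<bullet> e \<le> v i \<bullet> e"
      using that i unfolding tied_def by (blast intro: eq_refl)
    then have "i \<in> limiting_pattern S v ?x e"
      using i unfolding limiting_pattern_def argmax_set_def by blast
    from directional_eq[OF this] show ?thesis by (simp add: inner_add_left)
  qed
  have "tied (pattern S v ?x) (- d)" using subspace_neg[OF subspace_tied, of d] d by simp
  from minimizer_variational_inequality[OF sym r min, of d] dir[OF d]
    minimizer_variational_inequality[OF sym r min, of "- d"] dir[OF this]
  show ?thesis by (simp add: inner_diff_right inner_add_left inner_add_right inner_commute)
qed

text \<open>Since \<open>q \<subseteq> p\<close>, points tied on \<open>p\<close> are tied on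
  \<open>q\<close>; the last clause makes this inclusion of subspaces proper, which is what a
  dimension count can use.\<close>

definition separated :: "'i set \<Rightarrow> 'i set \<Rightarrow> bool" where
  "separated q p \<longleftrightarrow> q \<subseteq> p \<and> p \<subseteq> S \<and> (\<exists>x. tied q x \<and> \<not> tied p x)"

definition normal :: "real ^ 'p ^ 'p \<Rightarrow> 'i set \<Rightarrow> 'i set \<Rightarrow> real ^ 'p" where
  "normal C q p = (SOME d. d \<noteq> 0 \<and> tied q d \<and> (\<forall>u. tied p u \<longrightarrow> d \<bullet> (C *v u) = 0))"

text \<open>The \<open>C\<close>-image of the space tied on \<open>p\<close> has at most the
  dimension of that space, which is less than the dimension of the space tied on \<open>q\<close>.
  The orthogonal complement of the image therefore meets the latter nontrivially.\<close>

lemma normal: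
  assumes "separated q p"
  shows "normal C q p \<noteq> 0" and "tied q (normal C q p)"
    and "tied p u \<Longrightarrow> normal C q p \<bullet> (C *v u) = 0"
proof -
  let ?U = "{u. tied p u}" and ?U' = "{u. tied q u}"
  let ?T = "(*v) C ` ?U"
  let ?P = "{y \<in> UNIV. \<forall>x\<in>?T. orthogonal x y}"
  have lin: "linear ((*v) C)" by (rule matrix_vector_mul_linear)
  have T: "subspace ?T" by (rule linear_subspace_image[OF lin subspace_tied])
  have P: "subspace ?P" using subspace_orthogonal_to_vectors[of ?T] by simp
  have "dim ?P + dim ?T = dim (UNIV :: (real ^ 'p) set)"
    by (rule dim_subspace_orthogonal_to_vectors[OF T subspace_UNIV subset_UNIV])
  moreover have "dim ?T \<le> dim ?U" by (rule dim_image_le[OF lin])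
  moreover have "dim ?U < dim ?U'"
  proof (rule dim_psubset)
    have "?U \<subset> ?U'" using assms unfolding separated_def tied_def by blast
    then show "span ?U \<subset> span ?U'" by (simp add: span_eq_iff[THEN iffD2, OF subspace_tied])
  qed
  moreover have "dim {x + y |x y. x \<in> ?P \<and> y \<in> ?U'} + dim (?P \<inter> ?U') = dim ?P + dim ?U'"
    by (rule dim_sums_Int[OF P subspace_tied])
  moreover have "dim {x + y |x y. x \<in> ?P \<and> y \<in> ?U'} \<le> dim (UNIV :: (real ^ 'p) set)"
    by (rule dim_subset) simp
  ultimately have "dim (?P \<inter> ?U') \<noteq> 0" by linarith
  then obtain d where "d \<in> ?P" "d \<in> ?U'" "d \<noteq> 0" by (auto simp: dim_eq_0)
  then have "\<exists>d. d \<noteq> 0 \<and> tied q d \<and> (\<forall>u. tied p u \<longrightarrow> d \<bullet> (C *v u) = 0)"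
    by (intro exI[of _ d]) (auto simp: orthogonal_def inner_commute)
  from someI_ex[OF this]
  show "normal C q p \<noteq> 0" "tied q (normal C q p)" "tied p u \<Longrightarrow> normal C q p \<bullet> (C *v u) = 0"
    unfolding normal_def by blast+
qed

text \<open>Suppose that the rescaled minimizers converge to \<open>u\<close> with limiting pattern \<open>p\<close>, but keep
  a pattern \<open>q\<close> strictly contained in \<open>p\<close>. Then the limit of their stationarity conditions
  confines \<open>w\<close> to a translate of the sum of the \<open>C\<close>-image of \<open>{u. tied p u}\<close> and the span of
  the differences \<open>v i - v j\<close> for \<open>i, j\<close> in \<open>q\<close>. By dimension this sum is orthogonal to some
  \<open>normal C q p \<noteq> 0\<close>, so \<open>w\<close> lies in a hyperplane.\<close>

definition generic :: "real ^ 'p ^ 'p \<Rightarrow> real ^ 'p \<Rightarrow> real ^ 'p \<Rightarrow> bool" where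
  "generic C b w \<longleftrightarrow>
     (\<forall>q p. separated q p \<longrightarrow> (\<forall>i\<in>q. normal C q p \<bullet> (w - G b - v i) \<noteq> 0))"

section \<open>Limits of rescaled minimizers and stability of their patterns\<close>

text \<open>An index outside the limiting pattern loses at one of two scales: already at
  \<open>b\<close>, or only at first order in \<open>R k\<close>, against an index tied with it at
  \<open>b\<close>. Both losses are strict and survive small perturbations.\<close>

lemma eventually_pattern_subset_limiting:
  assumes R: "\<And>k. R k > 0" "R \<longlonglongrightarrow> 0" and U: "U \<longlonglongrightarrow> u"
  shows "eventually (\<lambda>k. pattern S v (b + R k *\<^sub>R U k) \<subseteq> limiting_pattern S v b u) sequentially"
proof -
  have "eventually (\<lambda>k. j \<notin> pattern S v (b + R k *\<^sub>R U k)) sequentially"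
    if j: "j \<in> S - limiting_pattern S v b u" for j
  proof (cases "j \<in> pattern S v b")
    case True
    then obtain i where i: "i \<in> pattern S v b" "v j \<bullet> u < v i \<bullet> u"
      using j unfolding limiting_pattern_def argmax_set_def by (auto simp: not_le)
    have eq: "v j \<bullet> b = v i \<bullet> b" using tied_pattern[of b] True i(1) unfolding tied_def by blast
    have "(\<lambda>k. v i \<bullet> U k - v j \<bullet> U k) \<longlonglongrightarrow> v i \<bullet> u - v j \<bullet> u" by (intro tendsto_intros U)
    then have "eventually (\<lambda>k. 0 < v i \<bullet> U k - v j \<bullet> U k) sequentially"
      using i(2) by (intro order_tendstoD) auto
    then show ?thesis
    proof eventually_elim
      case (elim k)
      then have "v j \<bullet> (b + R k *\<^sub>R U k) < v i \<bullet> (b + R k *\<^sub>R U k)"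
        using R(1)[of k] eq by (simp add: inner_add_right)
      moreover have "i \<in> S" by (rule subsetD[OF pattern_subset i(1)])
      ultimately show ?case unfolding pattern_def argmax_set_def by (auto simp: not_le)
    qed
  next
    case False
    then obtain i where i: "i \<in> S" "v j \<bullet> b < v i \<bullet> b"
      using j unfolding pattern_def argmax_set_def by (auto simp: not_le)
    have "(\<lambda>k. v i \<bullet> (b + R k *\<^sub>R U k) - v j \<bullet> (b + R k *\<^sub>R U k))
        \<longlonglongrightarrow> v i \<bullet> (b + 0 *\<^sub>R u) - v j \<bullet> (b + 0 *\<^sub>R u)"
      by (intro tendsto_intros U R)
    then have "eventually (\<lambda>k. 0 < v i \<bullet> (b + R k *\<^sub>R U k) - v j \<bullet> (b + R k *\<^sub>R U k)) sequentially"
      using i(2) by (intro order_tendstoD) auto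
    then show ?thesis
      by eventually_elim (use i(1) in \<open>auto simp: pattern_def argmax_set_def not_le\<close>)
  qed
  then have "eventually (\<lambda>k. \<forall>j\<in>S - limiting_pattern S v b u. j \<notin> pattern S v (b + R k *\<^sub>R U k)) sequentially"
    using finite_S by (intro eventually_ball_finite) auto
  then show ?thesis
  proof eventually_elim
    case (elim k)
    then show ?case using subsetD[OF pattern_subset[of S v "b + R k *\<^sub>R U k"]] by blast
  qed
qed

text \<open>By \<open>directional_le\<close> the increment at the moving point \<open>U k\<close> is
  bounded below by the continuous function \<open>directional b\<close>. Convergence of the
  increments is then needed only at the fixed competitor \<open>z\<close>, so pointwise convergence
  suffices.\<close>

lemma minimizers_limit:
  assumes R: "\<And>k. R k > 0" "R \<longlonglongrightarrow> 0" and A: "A \<longlonglongrightarrow> C" and w: "W \<longlonglongrightarrow> w" and U: "U \<longlonglongrightarrow> u"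
    and min: "\<And>k. is_minimizer (quadratic_objective (A k) (W k) (increment b (R k))) (U k)"
  shows "is_minimizer (quadratic_objective C w (directional b)) u"
  unfolding is_minimizer_iff
proof
  fix z
  have "(directional b \<longlongrightarrow> directional b u) (at u)"
    using continuous_directional by (auto simp: continuous_on_def)
  then have "(\<lambda>k. directional b (U k)) \<longlonglongrightarrow> directional b u"
    using U by (intro isCont_tendsto_compose[of u "directional b"]) (simp_all add: isCont_def)
  then have 1: "(\<lambda>k. quadratic_objective (A k) (W k) (directional b) (U k))
      \<longlonglongrightarrow> quadratic_objective C w (directional b) u"
    unfolding quadratic_objective_def by (intro tendsto_intros A w U)
  have "filterlim R (at_right 0) sequentially"
    using R(2) less_imp_neq[OF R(1)] R(1) by (auto simp: filterlim_at)
  then have "(\<lambda>k. increment b (R k) z) \<longlonglongrightarrow> directional b z"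
    unfolding increment_def by (rule filterlim_compose[OF tendsto_directional])
  then have 2: "(\<lambda>k. quadratic_objective (A k) (W k) (increment b (R k)) z)
      \<longlonglongrightarrow> quadratic_objective C w (directional b) z"
    unfolding quadratic_objective_def by (intro tendsto_intros A w)
  have "quadratic_objective (A k) (W k) (directional b) (U k)
      \<le> quadratic_objective (A k) (W k) (increment b (R k)) z" for k
  proof -
    have "quadratic_objective (A k) (W k) (directional b) (U k)
        \<le> quadratic_objective (A k) (W k) (increment b (R k)) (U k)"
      unfolding quadratic_objective_def increment_def using directional_le[OF R(1)] by simp
    also have "\<dots> \<le> quadratic_objective (A k) (W k) (increment b (R k)) z"
      using min by (simp add: is_minimizer_iff)
    finally show ?thesis .
  qed
  then show "quadratic_objective C w (directional b) u \<le> quadratic_objective C w (directional b) z"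
    using LIMSEQ_le[OF 1 2] by blast
qed

lemma minimizers_pattern_eventually:
  assumes R: "\<And>k. R k > 0" "R \<longlonglongrightarrow> 0" and A: "A \<longlonglongrightarrow> C" and sym: "\<And>k. transpose (A k) = A k"
    and w: "W \<longlonglongrightarrow> w" and U: "U \<longlonglongrightarrow> u"
    and min: "\<And>k. is_minimizer (quadratic_objective (A k) (W k) (increment b (R k))) (U k)"
    and gen: "generic C b w"
  shows "eventually (\<lambda>k. pattern S v (b + R k *\<^sub>R U k) = limiting_pattern S v b u) sequentially"
proof -
  let ?x = "\<lambda>k. b + R k *\<^sub>R U k" and ?p = "limiting_pattern S v b u"
  have pS: "?p \<subseteq> S" using limiting_pattern_subset pattern_subset by (rule order_trans)
  have "eventually (\<lambda>k. pattern S v (?x k) \<noteq> q) sequentially" if q: "q \<in> Pow ?p - {?p}" for q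
  proof (cases "separated q ?p \<and> q \<noteq> {}")
    case True
    then have sep: "separated q ?p" by simp
    obtain i where i: "i \<in> q" using True by blast
    let ?d = "normal C q ?p"
    have "?x \<longlonglongrightarrow> b + 0 *\<^sub>R u" by (intro tendsto_intros R U)
    then have "?x \<longlonglongrightarrow> b" by simp
    moreover have "isCont G b" using continuous_G by (simp add: continuous_on_eq_continuous_at)
    ultimately have "(\<lambda>k. G (?x k)) \<longlonglongrightarrow> G b" by (rule isCont_tendsto_compose[rotated])
    then have lim: "(\<lambda>k. ?d \<bullet> (W k - A k *v U k - G (?x k) - v i)) \<longlonglongrightarrow> ?d \<bullet> (w - C *v u - G b - v i)"
      by (intro tendsto_intros w A U)
    have "?d \<bullet> (C *v u) = 0" by (rule normal(3)[OF sep tied_limiting_pattern])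
    then have "?d \<bullet> (w - C *v u - G b - v i) = ?d \<bullet> (w - G b - v i)" by (simp add: inner_diff_right)
    also have "\<dots> \<noteq> 0" using gen sep i unfolding generic_def by blast
    finally have "eventually (\<lambda>k. ?d \<bullet> (W k - A k *v U k - G (?x k) - v i) \<noteq> 0) sequentially"
      by (rule tendsto_imp_eventually_ne[OF lim])
    then show ?thesis
    proof eventually_elim
      case (elim k)
      then show ?case
        using minimizer_stationary[OF sym R(1) min, of k ?d i] normal(2)[OF sep] i by blast
    qed
  next
    case False
    \<comment> \<open>Either \<open>q\<close> is empty, which a pattern never is, or ties on
      \<open>q\<close> force ties on all of the limiting pattern; then an index outside
      \<open>q\<close> attains the maximum as well.\<close>
    have "pattern S v (?x k) \<noteq> q" for k
    proof
      assume eq: "pattern S v (?x k) = q"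
      then have qn: "q \<noteq> {}" using pattern_nonempty by blast
      have "tied q (?x k)" using tied_pattern eq by blast
      then have "tied ?p (?x k)" using False qn q pS unfolding separated_def by blast
      obtain j where j: "j \<in> ?p" "j \<notin> q" using q by blast
      obtain i where i: "i \<in> q" using qn by blast
      have "v j \<bullet> ?x k = v i \<bullet> ?x k" using \<open>tied ?p (?x k)\<close> i j q unfolding tied_def by blast
      moreover have "i \<in> pattern S v (?x k)" using eq i by simp
      ultimately have "j \<in> pattern S v (?x k)"
        using j pS unfolding pattern_def argmax_set_def by auto
      then show False using eq j by simp
    qed
    then show ?thesis by simp
  qed
  moreover have "finite (Pow ?p - {?p})" using finite_subset[OF pS finite_S] by simp
  ultimately have "eventually (\<lambda>k. \<forall>q\<in>Pow ?p - {?p}. pattern S v (?x k) \<noteq> q) sequentially"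
    by (intro eventually_ball_finite) auto
  then show ?thesis
    using eventually_pattern_subset_limiting[OF R U, of b]
    by eventually_elim blast
qed

lemma directional_linear_bound: "\<exists>s. \<forall>u. s \<bullet> u \<le> directional b u"
  using directional_ge pattern_nonempty by blast

text \<open>By contradiction and compactness: counterexamples for values of \<open>\<delta>\<close>
  tending to 0 have scores approaching \<open>K\<close> and bounded minimizers, and a convergent
  subsequence contradicts \<open>minimizers_pattern_eventually\<close>.\<close>

lemma pattern_stability:
  assumes C: "pos_def_matrix C" and K: "compact K" "K \<noteq> {}"
    and gen: "\<And>w. w \<in> K \<Longrightarrow> generic C b w"
    and pat: "\<And>w u. w \<in> K \<Longrightarrow> is_minimizer (quadratic_objective C w (directional b)) u \<Longrightarrow>
      limiting_pattern S v b u = p"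
  shows "\<exists>\<delta>>0. \<forall>r A w u. 0 < r \<longrightarrow> r < \<delta> \<longrightarrow> transpose A = A \<longrightarrow> norm (A - C) < \<delta> \<longrightarrow>
    infdist w K < \<delta> \<longrightarrow> is_minimizer (quadratic_objective A w (increment b r)) u \<longrightarrow>
    pattern S v (b + r *\<^sub>R u) = p"
proof (rule ccontr)
  assume no_delta: "\<not> ?thesis"
  obtain \<kappa> where \<kappa>: "\<kappa> > 0" "\<And>u. \<kappa> * (norm u)\<^sup>2 \<le> u \<bullet> (C *v u)"
    using pos_def_matrix_lower_bound[OF C] by blast
  obtain s where s: "\<And>u. s \<bullet> u \<le> directional b u" using directional_linear_bound by blast
  \<comment> \<open>At most \<open>\<kappa> / 2\<close> keeps the quadratic forms coercive, at most
    1 keeps the scores within distance 1 of \<open>K\<close>; together they give the common bound on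
    the minimizers.\<close>
  define e where "e k = min 1 (\<kappa> / 2) / real (Suc k)" for k
  have e: "e k > 0" "e k \<le> \<kappa> / 2" "e k \<le> 1" for k
  proof -
    show "e k > 0" unfolding e_def using \<kappa>(1) by simp
    have "min 1 (\<kappa> / 2) / real (Suc k) \<le> min 1 (\<kappa> / 2) / 1"
      using \<kappa>(1) by (intro divide_left_mono) auto
    then have "e k \<le> min 1 (\<kappa> / 2)" by (simp add: e_def)
    then show "e k \<le> \<kappa> / 2" "e k \<le> 1" by auto
  qed
  have e0: "e \<longlonglongrightarrow> 0" unfolding e_def
    by (rule LIMSEQ_Suc) (rule lim_const_over_n)
  define bad where "bad k r A w u w' \<longleftrightarrow> 0 < r \<and> r < e k \<and> transpose A = A \<and> norm (A - C) < e k \<and>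
      w' \<in> K \<and> dist w w' < e k \<and> is_minimizer (quadratic_objective A w (increment b r)) u \<and>
      pattern S v (b + r *\<^sub>R u) \<noteq> p" for k r A w u w'
  have "\<exists>r A w u w'. bad k r A w u w'" for k
  proof (rule ccontr)
    assume H: "\<not> ?thesis"
    show False
    proof (rule notE[OF no_delta], intro exI[of _ "e k"] conjI allI impI e(1), rule ccontr)
      fix r A w u
      assume *: "0 < r" "r < e k" "transpose A = A" "norm (A - C) < e k" "infdist w K < e k"
        "is_minimizer (quadratic_objective A w (increment b r)) u" "pattern S v (b + r *\<^sub>R u) \<noteq> p"
      obtain w' where "w' \<in> K" "infdist w K = dist w w'"
        using infdist_attains_inf[OF compact_imp_closed[OF K(1)] K(2)] by blast
      with * have "bad k r A w u w'" by (simp add: bad_def)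
      with H show False by blast
    qed
  qed
  then obtain R A W U W' where "\<And>k. bad k (R k) (A k) (W k) (U k) (W' k)" by metis
  then have seq: "\<And>k. 0 < R k" "\<And>k. R k < e k" "\<And>k. transpose (A k) = A k"
    "\<And>k. norm (A k - C) < e k" "\<And>k. W' k \<in> K" "\<And>k. dist (W k) (W' k) < e k"
    "\<And>k. is_minimizer (quadratic_objective (A k) (W k) (increment b (R k))) (U k)"
    "\<And>k. pattern S v (b + R k *\<^sub>R U k) \<noteq> p"
    unfolding bad_def by blast+
  obtain B where B: "\<And>w. w \<in> K \<Longrightarrow> norm w \<le> B" using compact_imp_bounded[OF K(1)] unfolding bounded_iff by blast
  have Ub: "U k \<in> cball 0 (2 * ((B + 1) + norm s) / (\<kappa> / 2))" for k
  proof -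
    have inc: "s \<bullet> u \<le> increment b (R k) u" for u
      using s directional_le[OF seq(1)] unfolding increment_def by (rule order_trans)
    have "norm (A k - C) \<le> \<kappa> / 2" using seq(4)[of k] e(2)[of k] by linarith
    from quadratic_objective_minimizer_bound[OF _ quadratic_form_perturbation[OF \<kappa>(2) this] inc increment_zero seq(7)]
    have "norm (U k) \<le> 2 * (norm (W k) + norm s) / (\<kappa> / 2)" using \<kappa>(1) by simp
    also have "\<dots> \<le> 2 * ((B + 1) + norm s) / (\<kappa> / 2)"
    proof -
      have "norm (W k) \<le> norm (W' k) + dist (W k) (W' k)"
        by (simp add: dist_norm norm_triangle_sub)
      then have "norm (W k) \<le> B + 1" using B[OF seq(5)[of k]] seq(6)[of k] e(3)[of k] by linarith
      then show ?thesis using \<kappa>(1) by (intro divide_right_mono) auto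
    qed
    finally show ?thesis by simp
  qed
  have "\<exists>l\<in>K. \<exists>\<rho>. strict_mono \<rho> \<and> (W' \<circ> \<rho>) \<longlonglongrightarrow> l"
    using K(1) seq(5) unfolding compact_def by blast
  then obtain w \<rho> where w: "w \<in> K" and \<rho>: "strict_mono \<rho>" "(W' \<circ> \<rho>) \<longlonglongrightarrow> w" by blast
  have "\<exists>l\<in>cball 0 (2 * ((B + 1) + norm s) / (\<kappa> / 2)). \<exists>\<tau>. strict_mono \<tau> \<and> ((U \<circ> \<rho>) \<circ> \<tau>) \<longlonglongrightarrow> l"
    using compact_cball Ub unfolding compact_def by (metis comp_apply)
  then obtain u \<tau> where \<tau>: "strict_mono \<tau>" "((U \<circ> \<rho>) \<circ> \<tau>) \<longlonglongrightarrow> u" by blast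
  define \<phi> where "\<phi> = \<rho> \<circ> \<tau>"
  have \<phi>: "strict_mono \<phi>" unfolding \<phi>_def by (rule strict_mono_o[OF \<rho>(1) \<tau>(1)])
  have e\<phi>: "(\<lambda>k. e (\<phi> k)) \<longlonglongrightarrow> 0" using LIMSEQ_subseq_LIMSEQ[OF e0 \<phi>] by (simp add: comp_def)
  have U: "(\<lambda>k. U (\<phi> k)) \<longlonglongrightarrow> u" using \<tau>(2) by (simp add: \<phi>_def comp_def)
  have W': "(\<lambda>k. W' (\<phi> k)) \<longlonglongrightarrow> w"
    using LIMSEQ_subseq_LIMSEQ[OF \<rho>(2) \<tau>(1)] by (simp add: \<phi>_def comp_def)
  have R: "(\<lambda>k. R (\<phi> k)) \<longlonglongrightarrow> 0"
    by (rule tendsto_sandwich[OF always_eventually always_eventually tendsto_const e\<phi>])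
      (simp_all add: less_imp_le[OF seq(1)] less_imp_le[OF seq(2)])
  have "(\<lambda>k. A (\<phi> k) - C) \<longlonglongrightarrow> 0"
    by (rule Lim_null_comparison[OF always_eventually e\<phi>]) (simp add: less_imp_le[OF seq(4)])
  then have A: "(\<lambda>k. A (\<phi> k)) \<longlonglongrightarrow> C" by (rule LIM_zero_cancel)
  have "(\<lambda>k. W (\<phi> k) - W' (\<phi> k)) \<longlonglongrightarrow> 0"
    by (rule Lim_null_comparison[OF always_eventually e\<phi>])
      (simp add: less_imp_le[OF seq(6)] flip: dist_norm)
  from tendsto_add[OF this W'] have W: "(\<lambda>k. W (\<phi> k)) \<longlonglongrightarrow> w" by simp
  have "limiting_pattern S v b u = p"
    by (rule pat[OF w minimizers_limit[OF seq(1) R A W U seq(7)]])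
  moreover have "eventually (\<lambda>k. pattern S v (b + R (\<phi> k) *\<^sub>R U (\<phi> k)) = limiting_pattern S v b u) sequentially"
    by (rule minimizers_pattern_eventually[OF seq(1) R A seq(3) W U seq(7) gen[OF w]])
  ultimately have "eventually (\<lambda>k. False) sequentially" using seq(8) by simp
  then show False by simp
qed

end

section \<open>Convergence of the pattern probabilities\<close>

text \<open>If each component asymptotically loses at most \<open>\<eta>\<close>, the fixed total
  lets component \<open>i\<close> gain at most what the others lose.\<close>

lemma tendsto_of_lower_bounds:
  fixes a :: "nat \<Rightarrow> 'i \<Rightarrow> real" and b :: "'i \<Rightarrow> real"
  assumes I: "finite I" "i \<in> I" and a: "\<And>n. (\<Sum>j\<in>I. a n j) = s" and b: "(\<Sum>j\<in>I. b j) = s"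
    and lower: "\<And>j e. j \<in> I \<Longrightarrow> e > 0 \<Longrightarrow> eventually (\<lambda>n. b j - e \<le> a n j) sequentially"
  shows "(\<lambda>n. a n i) \<longlonglongrightarrow> b i"
proof (rule tendstoI)
  fix e :: real assume e: "e > 0"
  \<comment> \<open>The denominator makes \<open>card I\<close> losses of \<open>\<eta>\<close> add
    up to less than \<open>e\<close>.\<close>
  define \<eta> where "\<eta> = e / (real (card I) + 1)"
  have \<eta>0: "\<eta> > 0" unfolding \<eta>_def using e by (intro divide_pos_pos) auto
  then have "real (card I) * \<eta> < (real (card I) + 1) * \<eta>" by simp
  also have "\<dots> = e" by (simp add: \<eta>_def add_nonneg_eq_0_iff)
  finally have \<eta>: "\<eta> > 0" "real (card I) * \<eta> < e" using \<eta>0 by auto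
  have card: "card I \<ge> 1" using I by (auto simp: Suc_le_eq card_gt_0_iff)
  have "eventually (\<lambda>n. \<forall>j\<in>I. b j - \<eta> \<le> a n j) sequentially"
    using I lower \<eta>(1) by (intro eventually_ball_finite) auto
  then show "eventually (\<lambda>n. dist (a n i) (b i) < e) sequentially"
  proof eventually_elim
    case (elim n)
    have "(\<Sum>j\<in>I - {i}. b j - \<eta>) \<le> (\<Sum>j\<in>I - {i}. a n j)"
      using elim by (intro sum_mono) auto
    moreover have "(\<Sum>j\<in>I - {i}. b j - \<eta>) = (\<Sum>j\<in>I - {i}. b j) - real (card (I - {i})) * \<eta>"
      by (simp add: sum_subtractf)
    moreover have "real (card (I - {i})) * \<eta> \<le> real (card I) * \<eta>"
      using I \<eta>(1) by (intro mult_right_mono) (auto intro: card_mono)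
    moreover have "(\<Sum>j\<in>I. a n j) = a n i + (\<Sum>j\<in>I - {i}. a n j)" "(\<Sum>j\<in>I. b j) = b i + (\<Sum>j\<in>I - {i}. b j)"
      using I by (simp_all add: sum.remove)
    ultimately have "a n i \<le> b i + real (card I) * \<eta>" using a[of n] b by linarith
    moreover have "1 * \<eta> \<le> real (card I) * \<eta>" using card \<eta>(1) by (intro mult_right_mono) auto
    then have "b i - real (card I) * \<eta> \<le> a n i" using elim I(2) by force
    ultimately show ?case using \<eta>(2) by (simp add: dist_real_def abs_less_iff)
  qed
qed

lemma (in prob_space) sum_prob_fibres:
  assumes "finite I" "\<And>\<omega>. \<omega> \<in> space M \<Longrightarrow> F \<omega> \<in> I"
    and "\<And>i. i \<in> I \<Longrightarrow> {\<omega> \<in> space M. F \<omega> = i} \<in> events"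
  shows "(\<Sum>i\<in>I. prob {\<omega> \<in> space M. F \<omega> = i}) = 1"
proof -
  have "(\<Sum>i\<in>I. prob {\<omega> \<in> space M. F \<omega> = i}) = prob (\<Union>i\<in>I. {\<omega> \<in> space M. F \<omega> = i})"
    using assms by (intro finite_measure_finite_Union[symmetric]) (auto simp: disjoint_family_on_def)
  also have "(\<Union>i\<in>I. {\<omega> \<in> space M. F \<omega> = i}) = space M" using assms(2) by auto
  finally show ?thesis by (simp add: prob_space)
qed

lemma borel_argmax_set:
  assumes "finite A"
  shows "{x :: 'v::euclidean_space. argmax_set A (\<lambda>i. v i \<bullet> x) = q} \<in> sets borel"
proof (cases "q \<subseteq> A")
  case True
  then have "{x. argmax_set A (\<lambda>i. v i \<bullet> x) = q} = {x. \<forall>i\<in>A. (\<forall>j\<in>A. v j \<bullet> x \<le> v i \<bullet> x) \<longleftrightarrow> i \<in> q}"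
    unfolding argmax_set_def by blast
  also have "\<dots> = {x \<in> space borel. \<forall>i\<in>A. (\<forall>j\<in>A. v j \<bullet> x \<le> v i \<bullet> x) \<longleftrightarrow> i \<in> q}" by simp
  also have "\<dots> \<in> sets borel" using assms by measurable
  finally show ?thesis .
next
  case False
  then have "{x. argmax_set A (\<lambda>i. v i \<bullet> x) = q} = {}" unfolding argmax_set_def by auto
  then show ?thesis by simp
qed

lemma borel_pattern: "finite S \<Longrightarrow> {x. pattern S v x = q} \<in> sets (borel :: 'v::euclidean_space measure)"
  unfolding pattern_def by (rule borel_argmax_set)

lemma gram_matrix_symmetric: "transpose (gram_matrix n x) = gram_matrix n x"
  by (simp add: gram_matrix_def transpose_def vec_eq_iff mult.commute)

lemma gram_matrix_quadratic_form: "u \<bullet> (gram_matrix n x *v u) = (\<Sum>i<n. (x i \<bullet> u)\<^sup>2) / real n"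
proof -
  have "(\<Sum>i<n. (x i \<bullet> u)\<^sup>2) = (\<Sum>i<n. \<Sum>j\<in>UNIV. \<Sum>k\<in>UNIV. u $ j * (x i $ j * x i $ k * u $ k))"
    by (simp add: inner_vec_def power2_eq_square sum_product mult_ac)
  also have "\<dots> = (\<Sum>j\<in>UNIV. \<Sum>k\<in>UNIV. \<Sum>i<n. u $ j * (x i $ j * x i $ k * u $ k))"
    by (subst sum.swap) (intro sum.cong refl sum.swap)
  also have "\<dots> / real n = u \<bullet> (gram_matrix n x *v u)"
    by (simp add: inner_vec_def matrix_vector_mult_def gram_matrix_def sum_distrib_left
        sum_distrib_right sum_divide_distrib mult_ac)
  finally show ?thesis by simp
qed

lemma normal_law_singleton:
  assumes "s > 0"
  shows "emeasure (normal_law m s) {c} = 0"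
proof -
  have "absolutely_continuous lborel (normal_law m s)"
    using assms unfolding normal_law_def by (simp add: absolutely_continuousI_density)
  moreover have "{c} \<in> null_sets lborel" by (rule null_setsI) auto
  ultimately show ?thesis unfolding absolutely_continuous_def by blast
qed

context max_linear_penalty
begin

section \<open>Rescaling of the least squares problem\<close>

text \<open>The penalty weight is the inverse of the step \<open>1 / sqrt n\<close>, which turns the
  penalty into a difference quotient. The last bracket is independent of \<open>u\<close> and leaves
  the minimizers unchanged.\<close>

lemma penalized_ls_rescaled:
  assumes n: "n > 0" and y: "\<And>i. i < n \<Longrightarrow> y i = x i \<bullet> b + \<epsilon> i"
  shows "penalized_ls n x y (\<lambda>b. sqrt (real n) * f b) (b + (1 / sqrt (real n)) *\<^sub>R u) =
    quadratic_objective (gram_matrix n x) (score n x \<epsilon>) (increment b (1 / sqrt (real n))) u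
      + (1 / 2 * (\<Sum>i<n. (\<epsilon> i)\<^sup>2) + sqrt (real n) * f b)"
proof -
  let ?r = "1 / sqrt (real n)"
  have "(\<Sum>i<n. (y i - x i \<bullet> (b + ?r *\<^sub>R u))\<^sup>2) = (\<Sum>i<n. (\<epsilon> i)\<^sup>2 - 2 * (?r * ((u \<bullet> x i) * \<epsilon> i)) + ?r\<^sup>2 * (x i \<bullet> u)\<^sup>2)"
    by (intro sum.cong refl) (simp add: y inner_add_right power2_diff inner_commute power_divide)
  also have "\<dots> = (\<Sum>i<n. (\<epsilon> i)\<^sup>2) - 2 * (u \<bullet> score n x \<epsilon>) + u \<bullet> (gram_matrix n x *v u)"
    using n by (simp add: sum.distrib sum_subtractf inner_score gram_matrix_quadratic_form
        power_divide flip: sum_distrib_left sum_divide_distrib)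
  finally have "1 / 2 * (\<Sum>i<n. (y i - x i \<bullet> (b + ?r *\<^sub>R u))\<^sup>2) =
      1 / 2 * (\<Sum>i<n. (\<epsilon> i)\<^sup>2) - u \<bullet> score n x \<epsilon> + 1 / 2 * (u \<bullet> (gram_matrix n x *v u))" by simp
  moreover have "sqrt (real n) * f (b + ?r *\<^sub>R u) = increment b ?r u + sqrt (real n) * f b"
    unfolding increment_def by (simp add: algebra_simps)
  ultimately show ?thesis unfolding penalized_ls_def quadratic_objective_def by simp
qed

lemma penalized_ls_minimizer_iff:
  assumes n: "n > 0" and y: "\<And>i. i < n \<Longrightarrow> y i = x i \<bullet> b + \<epsilon> i"
  shows "is_minimizer (penalized_ls n x y (\<lambda>b. sqrt (real n) * f b)) (b + (1 / sqrt (real n)) *\<^sub>R u) \<longleftrightarrow>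
    is_minimizer (quadratic_objective (gram_matrix n x) (score n x \<epsilon>) (increment b (1 / sqrt (real n)))) u"
proof -
  let ?r = "1 / sqrt (real n)" and ?P = "penalized_ls n x y (\<lambda>b. sqrt (real n) * f b)"
  have "(\<forall>z. ?P (b + ?r *\<^sub>R u) \<le> ?P z) \<longleftrightarrow> (\<forall>z. ?P (b + ?r *\<^sub>R u) \<le> ?P (b + ?r *\<^sub>R z))"
  proof (intro iffI allI)
    fix z assume "\<forall>z. ?P (b + ?r *\<^sub>R u) \<le> ?P (b + ?r *\<^sub>R z)"
    from spec[OF this, of "sqrt (real n) *\<^sub>R (z - b)"] n show "?P (b + ?r *\<^sub>R u) \<le> ?P z" by simp
  qed blast
  then show ?thesis
    unfolding is_minimizer_iff using penalized_ls_rescaled[OF n y] by simp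
qed

section \<open>The limit minimizer as a function of the score, and the exceptional scores\<close>

lemma limit_objective_eq: "limit_objective C w f b = quadratic_objective C w (directional b)"
  by (simp add: fun_eq_iff limit_objective_def quadratic_objective_def dir_deriv_eq)

text \<open>Each minimizer is tested against the other in the growth inequality. On adding, only
  linear terms remain, since the two objectives differ by \<open>z \<bullet> (w - w')\<close>. The
  case \<open>w = w'\<close> is uniqueness.\<close>

lemma limit_minimizer_lipschitz:
  assumes \<kappa>: "\<kappa> > 0" "\<And>u. \<kappa> * (norm u)\<^sup>2 \<le> u \<bullet> (C *v u)"
    and u: "is_minimizer (quadratic_objective C w (directional b)) u"
    and u': "is_minimizer (quadratic_objective C w' (directional b)) u'"
  shows "norm (u - u') \<le> 2 / \<kappa> * norm (w - w')"
proof (cases "u = u'")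
  case False
  have sym: "(u' - u) \<bullet> (C *v (u' - u)) = (u - u') \<bullet> (C *v (u - u'))"
    by (simp add: matrix_vector_mult_diff_distrib inner_diff_left inner_diff_right)
  have shift: "quadratic_objective C w' (directional b) z
      = quadratic_objective C w (directional b) z + z \<bullet> (w - w')" for z
    by (simp add: quadratic_objective_def inner_diff_right)
  have "(u - u') \<bullet> (w - w') = u \<bullet> (w - w') - u' \<bullet> (w - w')" by (rule inner_diff_left)
  then have "(u - u') \<bullet> (C *v (u - u')) / 2 \<le> (u - u') \<bullet> (w - w')"
    using quadratic_objective_growth[OF directional_midpoint u, of u']
      quadratic_objective_growth[OF directional_midpoint u', of u]
      sym shift[of u] shift[of u'] by linarith
  also have "\<dots> \<le> norm (u - u') * norm (w - w')" by (rule norm_cauchy_schwarz)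
  finally have "norm (u - u') * (\<kappa> * norm (u - u')) \<le> norm (u - u') * (2 * norm (w - w'))"
    using \<kappa>(2)[of "u - u'"] by (simp add: power2_eq_square mult_ac)
  then have "\<kappa> * norm (u - u') \<le> 2 * norm (w - w')" using False by (simp add: mult_le_cancel_left)
  then show ?thesis using \<kappa>(1) by (simp add: field_simps)
qed (use \<kappa> in simp)

text \<open>The minimizer is a continuous function of the linear term, so \<open>uhat\<close> is
  \<open>uh\<close> composed with \<open>W\<close> and the limiting-pattern events are
  measurable.\<close>

lemma continuous_limit_minimizer:
  assumes C: "pos_def_matrix C"
  obtains uh where "\<And>w u. is_minimizer (quadratic_objective C w (directional b)) u \<longleftrightarrow> u = uh w"
    and "continuous_on UNIV uh"
proof -
  obtain \<kappa> where \<kappa>: "\<kappa> > 0" "\<And>u. \<kappa> * (norm u)\<^sup>2 \<le> u \<bullet> (C *v u)"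
    using pos_def_matrix_lower_bound[OF C] by blast
  obtain s where s: "\<And>u. s \<bullet> u \<le> directional b u" using directional_linear_bound by blast
  have "\<forall>w. \<exists>u. is_minimizer (quadratic_objective C w (directional b)) u"
    using quadratic_objective_has_minimizer[OF \<kappa> s directional_zero continuous_directional] by blast
  from choice[OF this]
  obtain uh where uh: "\<And>w. is_minimizer (quadratic_objective C w (directional b)) (uh w)" by blast
  have "u = uh w" if "is_minimizer (quadratic_objective C w (directional b)) u" for w u
    using limit_minimizer_lipschitz[OF \<kappa> that uh[of w]] by simp
  moreover have "continuous_on UNIV uh"
  proof (rule continuous_at_imp_continuous_on, rule ballI, unfold isCont_def, rule metric_LIM_I)
    fix w and e :: real assume e: "e > 0"
    show "\<exists>\<delta>>0. \<forall>w'. w' \<noteq> w \<and> dist w' w < \<delta> \<longrightarrow> dist (uh w') (uh w) < e"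
    proof (intro exI conjI allI impI)
      show "e * \<kappa> / 2 > 0" using e \<kappa>(1) by simp
      fix w' assume "w' \<noteq> w \<and> dist w' w < e * \<kappa> / 2"
      then have "2 / \<kappa> * norm (w' - w) < e" using \<kappa>(1) by (simp add: dist_norm field_simps)
      then show "dist (uh w') (uh w) < e"
        using limit_minimizer_lipschitz[OF \<kappa> uh[of w'] uh[of w]] by (simp add: dist_norm)
    qed
  qed
  ultimately show ?thesis using that uh by blast
qed

definition nongeneric_indices :: "('i set \<times> 'i set \<times> 'i) set" where
  "nongeneric_indices = {(q, p, i). separated q p \<and> i \<in> q}"

lemma finite_nongeneric_indices: "finite nongeneric_indices"
proof (rule finite_subset)
  show "nongeneric_indices \<subseteq> Pow S \<times> Pow S \<times> S"
    unfolding nongeneric_indices_def separated_def by blast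
qed (use finite_S in simp)

lemma nongeneric_eq:
  "{w. \<not> generic C b w} = (\<Union>(q, p, i)\<in>nongeneric_indices. {w. normal C q p \<bullet> w = normal C q p \<bullet> (G b + v i)})"
  unfolding generic_def nongeneric_indices_def
  by (auto simp: inner_diff_right inner_add_right algebra_simps)

lemma borel_generic: "{w. generic C b w} \<in> sets borel"
proof -
  have "closed {w. \<not> generic C b w}"
    unfolding nongeneric_eq
    by (intro closed_UN finite_nongeneric_indices ballI) (auto simp: closed_hyperplane split: prod.splits)
  then have "- {w. \<not> generic C b w} \<in> sets borel" by (intro borel_open) auto
  then show ?thesis by (simp add: Collect_neg_eq)
qed

text \<open>A nonzero functional of \<open>W\<close> is normal with positive variance because
  \<open>C\<close> is positive definite, hence has no atoms; finitely many hyperplanes then have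
  probability 0.\<close>

lemma AE_generic:
  assumes N: "prob_space N" and W: "multivariate_normal N W 0 (\<tau> *\<^sub>R C)"
    and C: "pos_def_matrix C" and \<tau>: "\<tau> > 0"
  shows "AE \<omega> in N. generic C b (W \<omega>)"
proof -
  have Wm [measurable]: "W \<in> borel_measurable N" using W unfolding multivariate_normal_def by blast
  have "AE \<omega> in N. \<forall>(q, p, i)\<in>nongeneric_indices. normal C q p \<bullet> W \<omega> \<noteq> normal C q p \<bullet> (G b + v i)"
  proof (intro AE_finite_allI[OF finite_nongeneric_indices])
    fix z assume z: "z \<in> nongeneric_indices"
    obtain q p i where qpi: "z = (q, p, i)" by (cases z) auto
    let ?d = "normal C q p" and ?c = "normal C q p \<bullet> (G b + v i)"
    have d: "?d \<noteq> 0" using z normal(1) unfolding qpi nongeneric_indices_def by blast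
    have "emeasure N {\<omega> \<in> space N. ?d \<bullet> W \<omega> = ?c} = emeasure (distr N borel (\<lambda>\<omega>. ?d \<bullet> W \<omega>)) {?c}"
      by (subst emeasure_distr) (auto intro!: arg_cong[where f = "emeasure N"])
    also have "distr N borel (\<lambda>\<omega>. ?d \<bullet> W \<omega>) = normal_law 0 (?d \<bullet> ((\<tau> *\<^sub>R C) *v ?d))"
      using W unfolding multivariate_normal_def by simp
    also have "emeasure \<dots> {?c} = 0"
      using C \<tau> d by (intro normal_law_singleton)
        (simp add: pos_def_matrix_def scaleR_matrix_vector_assoc[symmetric])
    finally have "AE \<omega> in N. ?d \<bullet> W \<omega> \<noteq> ?c"
      by (subst AE_iff_measurable[OF _ refl]) auto
    then show "AE \<omega> in N. case z of (q, p, i) \<Rightarrow> normal C q p \<bullet> W \<omega> \<noteq> normal C q p \<bullet> (G b + v i)"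
      unfolding qpi by simp
  qed
  then show ?thesis
  proof eventually_elim
    case (elim \<omega>)
    then have "W \<omega> \<notin> {w. \<not> generic C b w}" unfolding nongeneric_eq by auto
    then show ?case by simp
  qed
qed

theorem pattern_probability_tendsto:
  fixes M :: "'a measure" and N :: "'b measure"
    and X :: "nat \<Rightarrow> 'a \<Rightarrow> real ^ 'p" and eps y :: "nat \<Rightarrow> 'a \<Rightarrow> real"
  assumes lm: "linear_model M X eps C \<sigma>" and N: "prob_space N"
    and y: "\<And>i \<omega>. \<omega> \<in> space M \<Longrightarrow> y i \<omega> = X i \<omega> \<bullet> b + eps i \<omega>"
    and bhat [measurable]: "\<And>n. bhat n \<in> borel_measurable M"
    and bhat_min: "\<And>n \<omega>. \<omega> \<in> space M \<Longrightarrow>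
      (\<exists>b. is_minimizer (penalized_ls n (\<lambda>i. X i \<omega>) (\<lambda>i. y i \<omega>) (\<lambda>b. sqrt (real n) * f b)) b) \<Longrightarrow>
      is_minimizer (penalized_ls n (\<lambda>i. X i \<omega>) (\<lambda>i. y i \<omega>) (\<lambda>b. sqrt (real n) * f b)) (bhat n \<omega>)"
    and W: "multivariate_normal N W 0 (\<sigma>\<^sup>2 *\<^sub>R C)"
    and uhat_min: "\<And>\<omega>. \<omega> \<in> space N \<Longrightarrow> is_minimizer (limit_objective C (W \<omega>) f b) (uhat \<omega>)"
    and p: "p \<subseteq> S"
  shows "(\<lambda>n. measure M {\<omega> \<in> space M. pattern S v (bhat n \<omega>) = p})
    \<longlonglongrightarrow> measure N {\<omega> \<in> space N. limiting_pattern S v b (uhat \<omega>) = p}"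
proof -
  interpret lm: linear_model M X eps C \<sigma> by fact
  interpret N: prob_space N by fact
  have Wm [measurable]: "W \<in> borel_measurable N" using W unfolding multivariate_normal_def by blast
  obtain uh where uh: "\<And>w u. is_minimizer (quadratic_objective C w (directional b)) u \<longleftrightarrow> u = uh w"
    and uh_cont: "continuous_on UNIV uh"
    using continuous_limit_minimizer[OF lm.C] by metis
  have [measurable]: "uh \<in> borel_measurable borel" using uh_cont by (rule borel_measurable_continuous_onI)
  have uhat: "uhat \<omega> = uh (W \<omega>)" if "\<omega> \<in> space N" for \<omega>
    using uhat_min[OF that] by (simp add: limit_objective_eq uh)
  have limb [measurable]: "{w. limiting_pattern S v b (uh w) = q} \<in> sets borel" for q
  proof -
    have "{x. limiting_pattern S v b x = q} \<in> sets borel"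
      unfolding limiting_pattern_def by (rule borel_argmax_set[OF finite_pattern])
    then have "uh -` {x. limiting_pattern S v b x = q} \<inter> space borel \<in> sets borel" by measurable
    then show ?thesis by (simp add: vimage_def)
  qed
  have limev: "{\<omega> \<in> space N. limiting_pattern S v b (uhat \<omega>) = q} \<in> sets N" for q
  proof -
    have "{\<omega> \<in> space N. limiting_pattern S v b (uhat \<omega>) = q}
        = W -` {w. limiting_pattern S v b (uh w) = q} \<inter> space N" using uhat by auto
    then show ?thesis using measurable_sets[OF Wm limb] by simp
  qed
  have patev [measurable]: "{\<omega> \<in> space M. pattern S v (bhat n \<omega>) = q} \<in> sets M" for n q
  proof -
    have "{\<omega> \<in> space M. pattern S v (bhat n \<omega>) = q} = bhat n -` {x. pattern S v x = q} \<inter> space M" by auto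
    then show ?thesis using measurable_sets[OF bhat borel_pattern[OF finite_S]] by simp
  qed
  \<comment> \<open>The good scores for \<open>q\<close>: up to a null set their preimage under
    \<open>W\<close> is the limit event, and nonempty compact subsets satisfy the hypotheses of
    \<open>pattern_stability\<close>.\<close>
  define D where "D q = {w. generic C b w} \<inter> {w. limiting_pattern S v b (uh w) = q}" for q
  have D [measurable]: "D q \<in> sets borel" for q
    unfolding D_def using borel_generic by simp
  have limD: "measure N {\<omega> \<in> space N. limiting_pattern S v b (uhat \<omega>) = q} = measure (distr N borel W) (D q)" for q
  proof -
    have "measure N {\<omega> \<in> space N. limiting_pattern S v b (uhat \<omega>) = q} = measure N (W -` D q \<inter> space N)"
    proof (rule measure_eq_AE)
      show "AE \<omega> in N. (\<omega> \<in> {\<omega> \<in> space N. limiting_pattern S v b (uhat \<omega>) = q}) = (\<omega> \<in> W -` D q \<inter> space N)"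
        using AE_generic[OF N W lm.C lm.\<sigma>, of b] AE_space
        by eventually_elim (auto simp: D_def uhat)
    qed (use limev in simp_all)
    then show ?thesis by (simp add: measure_distr)
  qed
  obtain \<kappa> where \<kappa>: "\<kappa> > 0" "\<And>u. \<kappa> * (norm u)\<^sup>2 \<le> u \<bullet> (C *v u)"
    using pos_def_matrix_lower_bound[OF lm.C] by blast
  obtain s where s: "\<And>u. s \<bullet> u \<le> directional b u" using directional_linear_bound by blast
  have "eventually (\<lambda>n. measure N {\<omega> \<in> space N. limiting_pattern S v b (uhat \<omega>) = q} - e
      \<le> measure M {\<omega> \<in> space M. pattern S v (bhat n \<omega>) = q}) sequentially" if e: "e > 0" for q e
  proof -
    let ?\<mu> = "distr N borel W"
    interpret \<mu>: prob_space ?\<mu> by (rule N.prob_space_distr) simp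
    have "\<exists>K. K \<subseteq> D q \<and> compact K \<and> measure ?\<mu> (D q) - e / 3 \<le> measure ?\<mu> K"
    \<comment> \<open>\<open>ennreal\<close> sends negative numbers to 0, so a negative lower bound
      is treated apart; the empty set then does.\<close>
    proof (cases "measure ?\<mu> (D q) - e / 3 < 0")
      case True
      then show ?thesis by (intro exI[of _ "{}"]) simp
    next
      case False
      have "ennreal (measure ?\<mu> (D q) - e / 3) < emeasure ?\<mu> (D q)"
        using e False by (simp add: \<mu>.emeasure_eq_measure ennreal_less_iff)
      also have "emeasure ?\<mu> (D q) = (SUP K \<in> {K. K \<subseteq> D q \<and> compact K}. emeasure ?\<mu> K)"
        by (rule inner_regular) (auto simp: \<mu>.emeasure_eq_measure)
      finally obtain K where "K \<subseteq> D q" "compact K" "ennreal (measure ?\<mu> (D q) - e / 3) < emeasure ?\<mu> K"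
        unfolding less_SUP_iff by blast
      then show ?thesis using False by (auto simp: \<mu>.emeasure_eq_measure ennreal_less_iff intro!: exI[of _ K])
    qed
    then obtain K where K: "K \<subseteq> D q" "compact K" "measure ?\<mu> (D q) - e / 3 \<le> measure ?\<mu> K" by blast
    show ?thesis
    \<comment> \<open>\<open>infdist\<close> to the empty set is 0 by convention and describes no
      neighbourhood. For empty \<open>K\<close> the limit probability is at most
      \<open>e / 3\<close> and the claim is trivial.\<close>
    proof (cases "K = {}")
      case True
      then have "measure N {\<omega> \<in> space N. limiting_pattern S v b (uhat \<omega>) = q} - e \<le> 0"
        using K(3) e unfolding limD by simp
      then have "measure N {\<omega> \<in> space N. limiting_pattern S v b (uhat \<omega>) = q} - e \<le> measure M A" for A
        by (rule order_trans) simp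
      then show ?thesis by simp
    next
      case False
      have gen: "generic C b w" if "w \<in> K" for w using that K(1) unfolding D_def by blast
      have pat: "limiting_pattern S v b u = q"
        if w: "w \<in> K" and u: "is_minimizer (quadratic_objective C w (directional b)) u" for w u
      proof -
        have "u = uh w" using u by (simp add: uh)
        then show ?thesis using subsetD[OF K(1) w] by (simp add: D_def)
      qed
      have "\<exists>\<delta>>0. \<forall>r A w u. 0 < r \<longrightarrow> r < \<delta> \<longrightarrow> transpose A = A \<longrightarrow> norm (A - C) < \<delta> \<longrightarrow>
          infdist w K < \<delta> \<longrightarrow> is_minimizer (quadratic_objective A w (increment b r)) u \<longrightarrow>
          pattern S v (b + r *\<^sub>R u) = q"
        by (rule pattern_stability[OF lm.C K(2) False]) (fact gen, fact pat)
      then obtain \<delta> where \<delta>: "\<delta> > 0" and stable: "\<forall>r A w u. 0 < r \<longrightarrow> r < \<delta> \<longrightarrow>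
          transpose A = A \<longrightarrow> norm (A - C) < \<delta> \<longrightarrow> infdist w K < \<delta> \<longrightarrow>
          is_minimizer (quadratic_objective A w (increment b r)) u \<longrightarrow> pattern S v (b + r *\<^sub>R u) = q"
        by (elim exE conjE)
      \<comment> \<open>A continuous function between the indicators of \<open>K\<close> and of its
        \<open>\<delta>\<close>-neighbourhood, since the convergence of the scores is available only
        for continuous test functions.\<close>
      define h where "h w = max 0 (1 - infdist w K / \<delta>)" for w
      have h: "continuous_on UNIV h" "0 \<le> h w" "\<bar>h w\<bar> \<le> 1" "w \<in> K \<Longrightarrow> h w = 1" "\<not> infdist w K < \<delta> \<Longrightarrow> h w = 0" for w
        using \<delta> unfolding h_def
        by (auto intro!: continuous_intros simp: infdist_nonneg field_simps)
      have [measurable]: "h \<in> borel_measurable borel" using h(1) by (rule borel_measurable_continuous_onI)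
      define Y where "Y n \<omega> = score n (\<lambda>i. X i \<omega>) (\<lambda>i. eps i \<omega>)" for n \<omega>
      have [measurable]: "Y n \<in> borel_measurable M" for n unfolding Y_def by (rule lm.measurable_score)
      \<comment> \<open>\<open>\<delta>\<close> is for the stability of the pattern,
        \<open>\<kappa> / 2\<close> for coercivity, which gives existence of a minimizer and so
        makes \<open>bhat n\<close> one.\<close>
      define \<delta>' where "\<delta>' = min \<delta> (\<kappa> / 2)"
      have \<delta>': "\<delta>' > 0" using \<delta> \<kappa>(1) by (simp add: \<delta>'_def)
      define F where "F n = {\<omega> \<in> space M. (\<Sum>j\<in>UNIV. \<Sum>k\<in>UNIV. \<bar>(gram_matrix n (\<lambda>i. X i \<omega>) - C) $ j $ k\<bar>) \<ge> \<delta>'}" for n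
      have [measurable]: "F n \<in> sets M" for n
      proof -
        have [measurable]: "(\<lambda>\<omega>. \<Sum>j\<in>UNIV. \<Sum>k\<in>UNIV. \<bar>(gram_matrix n (\<lambda>i. X i \<omega>) - C) $ j $ k\<bar>) \<in> borel_measurable M"
          unfolding vector_minus_component
          by (intro borel_measurable_sum borel_measurable_abs borel_measurable_diff borel_measurable_const
              lm.measurable_gram_matrix_component)
        show ?thesis unfolding F_def by measurable
      qed
      have F0: "(\<lambda>n. measure M (F n)) \<longlonglongrightarrow> 0" unfolding F_def by (rule lm.gram_matrix_tendsto[OF \<delta>'])
      have Yh: "(\<lambda>n. lm.expectation (\<lambda>\<omega>. h (Y n \<omega>))) \<longlonglongrightarrow> N.expectation (\<lambda>\<omega>. h (W \<omega>))"
        unfolding Y_def by (rule lm.score_expectation_tendsto[OF N W h(1,3)])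
      have KM [measurable]: "K \<in> sets borel" using K(2) by (rule borel_compact)
      have "measure ?\<mu> K = N.expectation (\<lambda>\<omega>. indicator (W -` K \<inter> space N) \<omega>)"
        by (simp add: measure_distr)
      also have "\<dots> \<le> N.expectation (\<lambda>\<omega>. h (W \<omega>))"
      proof (rule integral_mono)
        show "integrable N (\<lambda>\<omega>. h (W \<omega>))"
          by (rule N.integrable_const_bound[where B = 1]) (auto simp: h(3))
        show "indicator (W -` K \<inter> space N) \<omega> \<le> h (W \<omega>)" for \<omega>
          using h(2,4)[of "W \<omega>"] by (auto split: split_indicator)
      qed (simp add: N.emeasure_eq_measure)
      finally have hK: "measure ?\<mu> K \<le> N.expectation (\<lambda>\<omega>. h (W \<omega>))" .
      have upper: "lm.expectation (\<lambda>\<omega>. h (Y n \<omega>))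
          \<le> measure M {\<omega> \<in> space M. pattern S v (bhat n \<omega>) = q} + measure M (F n)"
        if n: "n > 0" "1 / sqrt (real n) < \<delta>" for n
      proof -
        let ?B = "{\<omega> \<in> space M. infdist (Y n \<omega>) K < \<delta>}"
        have [measurable]: "(\<lambda>\<omega>. infdist (Y n \<omega>) K) \<in> borel_measurable M"
          by (rule borel_measurable_continuous_on[where f = "\<lambda>w. infdist w K"])
            (auto intro!: continuous_intros)
        have Bm [measurable]: "?B \<in> sets M" by measurable
        have "lm.expectation (\<lambda>\<omega>. h (Y n \<omega>)) \<le> lm.expectation (\<lambda>\<omega>. indicator ?B \<omega>)"
        proof (rule integral_mono)
          show "integrable M (\<lambda>\<omega>. h (Y n \<omega>))"
            by (rule lm.integrable_const_bound[where B = 1]) (auto simp: h(3))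
          show "h (Y n \<omega>) \<le> indicator ?B \<omega>" if "\<omega> \<in> space M" for \<omega>
            using h(3,5)[of "Y n \<omega>"] that by (auto split: split_indicator)
        qed (simp add: lm.emeasure_eq_measure)
        also have "\<dots> = measure M ?B" by simp
        also have "\<dots> \<le> measure M ({\<omega> \<in> space M. pattern S v (bhat n \<omega>) = q} \<union> F n)"
        proof (rule lm.finite_measure_mono)
          show "?B \<subseteq> {\<omega> \<in> space M. pattern S v (bhat n \<omega>) = q} \<union> F n"
          proof
            fix \<omega> assume "\<omega> \<in> ?B"
            then have \<omega>: "\<omega> \<in> space M" "infdist (Y n \<omega>) K < \<delta>" by auto
            let ?A = "gram_matrix n (\<lambda>i. X i \<omega>)" and ?r = "1 / sqrt (real n)"
            show "\<omega> \<in> {\<omega> \<in> space M. pattern S v (bhat n \<omega>) = q} \<union> F n"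
            proof (cases "\<omega> \<in> F n")
              case False
              then have A: "norm (?A - C) < \<delta>'"
                using \<omega>(1) norm_matrix_le_sum[of "?A - C"] by (simp add: F_def)
              have r: "?r > 0" using n by simp
              have inc: "s \<bullet> u \<le> increment b ?r u" for u
                using s directional_le[OF r] unfolding increment_def by (rule order_trans)
              have "norm (?A - C) \<le> \<kappa> / 2" using A by (simp add: \<delta>'_def)
              note form = quadratic_form_perturbation[OF \<kappa>(2) this]
              have iff: "is_minimizer (penalized_ls n (\<lambda>i. X i \<omega>) (\<lambda>i. y i \<omega>) (\<lambda>b. sqrt (real n) * f b)) (b + ?r *\<^sub>R u)
                  \<longleftrightarrow> is_minimizer (quadratic_objective ?A (Y n \<omega>) (increment b ?r)) u" for u
                unfolding Y_def by (rule penalized_ls_minimizer_iff[OF n(1) y[OF \<omega>(1)]])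
              have "\<exists>u. is_minimizer (quadratic_objective ?A (Y n \<omega>) (increment b ?r)) u"
                using \<kappa>(1) by (intro quadratic_objective_has_minimizer[OF _ form inc increment_zero continuous_increment]) simp
              then obtain u where "is_minimizer (quadratic_objective ?A (Y n \<omega>) (increment b ?r)) u" ..
              then have "is_minimizer (penalized_ls n (\<lambda>i. X i \<omega>) (\<lambda>i. y i \<omega>) (\<lambda>b. sqrt (real n) * f b)) (b + ?r *\<^sub>R u)"
                by (simp only: iff)
              then have min: "is_minimizer (penalized_ls n (\<lambda>i. X i \<omega>) (\<lambda>i. y i \<omega>) (\<lambda>b. sqrt (real n) * f b)) (bhat n \<omega>)"
                by (intro bhat_min[OF \<omega>(1)] exI)
              \<comment> \<open>The minimizer \<open>u\<close> only establishes existence; the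
                pattern is read off from the rescaled error of \<open>bhat n\<close> itself.\<close>
              define u' where "u' = sqrt (real n) *\<^sub>R (bhat n \<omega> - b)"
              have bu: "b + ?r *\<^sub>R u' = bhat n \<omega>" using n by (simp add: u'_def)
              have "is_minimizer (quadratic_objective ?A (Y n \<omega>) (increment b ?r)) u'"
                using min unfolding iff[symmetric] bu .
              then have "pattern S v (b + ?r *\<^sub>R u') = q"
                using A \<omega>(2) by (intro stable[rule_format, OF r n(2) gram_matrix_symmetric]) (auto simp: \<delta>'_def)
              then show ?thesis using \<omega>(1) bu by simp
            qed simp
          qed
        qed simp
        also have "\<dots> \<le> measure M {\<omega> \<in> space M. pattern S v (bhat n \<omega>) = q} + measure M (F n)"
          by (rule measure_Un_le) simp_all
        finally show ?thesis .
      qed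
      \<comment> \<open>Three losses of \<open>e / 3\<close>: inner approximation by
        \<open>K\<close>, convergence of the expectations of \<open>h\<close>, and the exceptional
        event \<open>F n\<close>.\<close>
      have "eventually (\<lambda>n. N.expectation (\<lambda>\<omega>. h (W \<omega>)) - e / 3 < lm.expectation (\<lambda>\<omega>. h (Y n \<omega>))) sequentially"
        using e by (intro order_tendstoD(1)[OF Yh]) simp
      moreover have "eventually (\<lambda>n. measure M (F n) < e / 3) sequentially"
        using e by (intro order_tendstoD(2)[OF F0]) simp
      moreover have "(\<lambda>n. 1 / sqrt (real n)) \<longlonglongrightarrow> 0"
        by (intro tendsto_divide_0[OF tendsto_const] filterlim_at_top_imp_at_infinity
            filterlim_compose[OF sqrt_at_top filterlim_real_sequentially])
      then have "eventually (\<lambda>n. 1 / sqrt (real n) < \<delta>) sequentially"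
        using \<delta> by (rule order_tendstoD(2))
      ultimately show ?thesis
        using eventually_gt_at_top[of 0]
      proof eventually_elim
        case (elim n)
        show ?case using upper[OF elim(4,3)] elim(1,2) hK K(3) unfolding limD by linarith
      qed
    qed
  qed
  \<comment> \<open>Summation runs over all subsets of \<open>S\<close>, so no description of the
    attainable patterns is needed; the other subsets contribute 0.\<close>
  moreover have "(\<Sum>q\<in>Pow S. measure M {\<omega> \<in> space M. pattern S v (bhat n \<omega>) = q}) = 1" for n
    by (rule lm.sum_prob_fibres) (simp_all add: finite_S pattern_subset patev)
  moreover have "(\<Sum>q\<in>Pow S. measure N {\<omega> \<in> space N. limiting_pattern S v b (uhat \<omega>) = q}) = 1"
  proof (rule N.sum_prob_fibres)
    show "limiting_pattern S v b (uhat \<omega>) \<in> Pow S" for \<omega>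
      using order_trans[OF limiting_pattern_subset pattern_subset] by simp
  qed (use finite_S limev in auto)
  ultimately show ?thesis
    using finite_S p
    by (intro tendsto_of_lower_bounds[where I = "Pow S" and s = 1
        and a = "\<lambda>n q. measure M {\<omega> \<in> space M. pattern S v (bhat n \<omega>) = q}"
        and b = "\<lambda>q. measure N {\<omega> \<in> space N. limiting_pattern S v b (uhat \<omega>) = q}"]) auto
qed

end

theorem corollary3p4:
  fixes M :: "'a measure" and N :: "'b measure"
    and X :: "nat \<Rightarrow> 'a \<Rightarrow> real ^ 'p" and eps :: "nat \<Rightarrow> 'a \<Rightarrow> real"
    and y :: "nat \<Rightarrow> 'a \<Rightarrow> real"
    and \<beta>\<^sub>0 :: "real ^ 'p" and C :: "real ^ 'p ^ 'p" and \<sigma> :: real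
    and f g :: "real ^ 'p \<Rightarrow> real" and S :: "'i set" and v :: "'i \<Rightarrow> real ^ 'p"
    and \<beta>hat :: "nat \<Rightarrow> 'a \<Rightarrow> real ^ 'p"
    and W uhat :: "'b \<Rightarrow> real ^ 'p"
    and \<pp> :: "'i set"
  assumes "prob_space M" and "prob_space N"
    and f: "max_linear_form f S v g"
    and X_iid: "iid M borel X"
    and X_cov: "\<And>i. centered_with_covariance M (X i) C"
    and C: "pos_def_matrix C"
    and eps_iid: "iid M borel eps"
    and eps_var: "\<And>i. centered_with_variance M (eps i) (\<sigma>\<^sup>2)"
    and \<sigma>: "\<sigma>\<^sup>2 > 0"
    and indep: "indep_sequences M X eps"
    and y: "\<And>i \<omega>. \<omega> \<in> space M \<Longrightarrow> y i \<omega> = X i \<omega> \<bullet> \<beta>\<^sub>0 + eps i \<omega>"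
    and \<beta>hat_measurable: "\<And>n. \<beta>hat n \<in> borel_measurable M"
    and \<beta>hat_min: "\<And>n \<omega>. \<omega> \<in> space M \<Longrightarrow>
      (\<exists>b. is_minimizer (penalized_ls n (\<lambda>i. X i \<omega>) (\<lambda>i. y i \<omega>) (\<lambda>b. sqrt (real n) * f b)) b) \<Longrightarrow>
      is_minimizer (penalized_ls n (\<lambda>i. X i \<omega>) (\<lambda>i. y i \<omega>) (\<lambda>b. sqrt (real n) * f b)) (\<beta>hat n \<omega>)"
    and W: "multivariate_normal N W 0 (\<sigma>\<^sup>2 *\<^sub>R C)"
    and uhat_min: "\<And>\<omega>. \<omega> \<in> space N \<Longrightarrow>
      is_minimizer (limit_objective C (W \<omega>) f \<beta>\<^sub>0) (uhat \<omega>)"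
    and \<pp>: "\<pp> \<in> patterns S v"
  shows "(\<lambda>n. measure M {\<omega> \<in> space M. pattern S v (\<beta>hat n \<omega>) = \<pp>})
           \<longlonglongrightarrow> measure N {\<omega> \<in> space N. limiting_pattern S v \<beta>\<^sub>0 (uhat \<omega>) = \<pp>}"
proof -
  obtain G where G: "\<And>x. GDERIV g x :> G x" "continuous_on UNIV G"
    using f unfolding max_linear_form_def by blast
  interpret max_linear_penalty f g S v G
    by unfold_locales (use f G in \<open>auto simp: max_linear_form_def\<close>)
  have model: "linear_model M X eps C \<sigma>"
    using \<open>prob_space M\<close> X_iid X_cov C eps_iid eps_var \<sigma> indep
    by (intro linear_model.intro linear_model_axioms.intro)
  have sub: "\<pp> \<subseteq> S" using \<pp> pattern_subset unfolding patterns_def by fast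
  show ?thesis
    by (rule pattern_probability_tendsto[OF model \<open>prob_space N\<close> y \<beta>hat_measurable \<beta>hat_min W uhat_min sub])
qed

end
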